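(* Let $|\xi\rangle=\sum_{n\ge0}\lambda_n|n\rangle$ be a normalized single-mode pure state with $|\xi\rangle\neq|0\rangle$ (so $|\lambda_0|<1$). Then there exist two-outcome projective measurements $\{\Pi^A_0,\Pi^A_1\}$ on mode $A$ and $\{\Pi^B_0,\Pi^B_1\}$ on mode $B$ (chosen independently of the inputs $x,y$) such that the GYNI value satisfies $\mathcal J>\tfrac12$ if and only if $|\xi\rangle$ is non-classical, i.e. $|\xi\rangle$ is not a coherent state $|\beta\rangle$ for any $\beta\in\mathbb C$. Equivalently: if $|\xi\rangle$ is a coherent state then $\mathcal J\le\tfrac12$ for every such choice of measurements, and if $|\xi\rangle$ is not a coherent state then some choice gives $\mathcal J>\tfrac12$.
   Context: Modes $A$ and $B$ have annihilation operators $a,b$ and Fock states $|n\rangle$. A coherent state is $|\beta\rangle=e^{-|\beta|^2/2}\sum_{n\ge0}\frac{\beta^n}{\sqrt{n!}}|n\rangle$, $\beta\in\mathbb C$; a single-mode pure state is called non-classical iff it is not a coherent state. For a normalized single-mode state $|\xi\rangle=\sum_n\lambda_n|n\rangle$ with $|\lambda_0|<1$ and input bits $x,y\in\{0,1\}$, the phase-encoded generalized NOON state is $|\Phi_{xy}\rangle=\mathcal N_{xy}^{-1/2}\big((-1)^x|\xi\rangle_A|0\rangle_B+(-1)^y|0\rangle_A|\xi\rangle_B\big)$ with $\mathcal N_{xy}=2(1+(-1)^{x+y}|\lambda_0|^2)$. The lossless 50:50 beam splitter is the unitary $U$ on the two modes with $U|0,0\rangle=|0,0\rangle$, $Ua^\dagger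 U^\dagger=(a^\dagger+b^\dagger)/\sqrt2$, $Ub^\dagger U^\dagger=(a^\dagger-b^\dagger)/\sqrt2$; set $|\Phi''_{xy}\rangle=U|\Phi_{xy}\rangle$. Given two-outcome projective measurements $\{\Pi^A_0,\Pi^A_1\}$ on mode $A$ and $\{\Pi^B_0,\Pi^B_1\}$ on mode $B$ ($\Pi_0+\Pi_1=I$), not depending on $x,y$, define $P(a,b|x,y)=\langle\Phi''_{xy}|\Pi^A_a\otimes\Pi^B_b|\Phi''_{xy}\rangle$ and the GYNI value $\mathcal J=\frac14\big[P(0,0|0,0)+P(0,0|1,1)+P(1,1|0,1)+P(1,1|1,0)\big]$. The GYNI inequality is $\mathcal J\le\frac12$; a violation means $\mathcal J>\frac12$. *)

theory Defs
  imports "HOL-Analysis.Analysis"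
begin

text \<open>Single-mode vectors are coefficient sequences in the Fock basis (nat => complex);
two-mode vectors are coefficient functions on pairs (m,n) of photon numbers.
Operators on one mode are given by their matrix elements M i j = <i|M|j>.\<close>

type_synonym mode_vec = "nat \<Rightarrow> complex"
type_synonym twomode_vec = "nat \<times> nat \<Rightarrow> complex"
type_synonym op_mat = "nat \<Rightarrow> nat \<Rightarrow> complex"

definition l2 :: "('a \<Rightarrow> complex) \<Rightarrow> bool" where
  "l2 v \<longleftrightarrow> (\<lambda>i. (cmod (v i))^2) summable_on UNIV"

definition sqnorm :: "('a \<Rightarrow> complex) \<Rightarrow> real" where
  "sqnorm v = (\<Sum>\<^sub>\<infinity>i. (cmod (v i))^2)"

definition mat_app :: "op_mat \<Rightarrow> mode_vec \<Rightarrow> mode_vec" where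
  "mat_app M v = (\<lambda>i. \<Sum>\<^sub>\<infinity>j. M i j * v j)"

definition is_projection :: "op_mat \<Rightarrow> bool" where
  "is_projection P \<longleftrightarrow>
     (\<forall>i. l2 (P i)) \<and>
     (\<forall>i j. P i j = cnj (P j i)) \<and>
     (\<exists>C. \<forall>v. l2 v \<longrightarrow> l2 (mat_app P v) \<and> sqnorm (mat_app P v) \<le> C * sqnorm v) \<and>
     (\<forall>v. l2 v \<longrightarrow> mat_app P (mat_app P v) = mat_app P v)"

definition two_outcome_pvm :: "op_mat \<Rightarrow> op_mat \<Rightarrow> bool" where
  "two_outcome_pvm P0 P1 \<longleftrightarrow> is_projection P0 \<and> is_projection P1 \<and>
     (\<forall>i j. P0 i j + P1 i j = (if i = j then 1 else 0))"

definition tensor_app :: "op_mat \<Rightarrow> op_mat \<Rightarrow> twomode_vec \<Rightarrow> twomode_vec" where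
  "tensor_app P Q \<Phi> = (\<lambda>(i, k). \<Sum>\<^sub>\<infinity>j. P i j * (\<Sum>\<^sub>\<infinity>l. Q k l * \<Phi> (j, l)))"

text \<open><Phi| P \<otimes> Q |Phi> (real part; it is real for self-adjoint P, Q).\<close>
definition expect2 :: "op_mat \<Rightarrow> op_mat \<Rightarrow> twomode_vec \<Rightarrow> real" where
  "expect2 P Q \<Phi> = Re (\<Sum>\<^sub>\<infinity>p. cnj (\<Phi> p) * tensor_app P Q \<Phi> p)"

text \<open>Matrix element <p,q|U|m,n> of the 50:50 beam splitter, obtained from
U|m,n> = ((a^+ + b^+)/sqrt 2)^m ((a^+ - b^+)/sqrt 2)^n |0,0> / sqrt(m! n!).\<close>
definition bs_coeff :: "nat \<Rightarrow> nat \<Rightarrow> nat \<Rightarrow> nat \<Rightarrow> complex" where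
  "bs_coeff p q m n =
    (if p + q = m + n then
       (\<Sum>j\<le>m. \<Sum>k\<le>n. if j + k = p
          then of_nat (m choose j) * of_nat (n choose k) * (-1) ^ (n - k) else 0)
       * complex_of_real (sqrt (fact p * fact q) / (sqrt (2 ^ (m + n)) * sqrt (fact m * fact n)))
     else 0)"

text \<open>U conserves total photon number, so each output coefficient is a finite sum.\<close>
definition beam_splitter :: "twomode_vec \<Rightarrow> twomode_vec" where
  "beam_splitter \<Phi> = (\<lambda>(p, q). \<Sum>m\<le>p + q. bs_coeff p q m (p + q - m) * \<Phi> (m, p + q - m))"

definition coherent :: "complex \<Rightarrow> mode_vec" where
  "coherent \<beta> n = complex_of_real (exp (- ((cmod \<beta>) ^ 2) / 2) / sqrt (fact n)) * \<beta> ^ n"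

text \<open>Pure states are rays: xi is (the state) a coherent state iff it equals some
|beta> up to a global phase.\<close>
definition is_coherent_state :: "mode_vec \<Rightarrow> bool" where
  "is_coherent_state \<xi> \<longleftrightarrow> (\<exists>\<beta> c. cmod c = 1 \<and> \<xi> = (\<lambda>n. c * coherent \<beta> n))"

definition noon_norm :: "mode_vec \<Rightarrow> nat \<Rightarrow> nat \<Rightarrow> real" where
  "noon_norm \<xi> x y = 2 * (1 + (-1) ^ (x + y) * (cmod (\<xi> 0))^2)"

definition noon :: "mode_vec \<Rightarrow> nat \<Rightarrow> nat \<Rightarrow> twomode_vec" where
  "noon \<xi> x y = (\<lambda>(m, n).
     ((-1) ^ x * \<xi> m * (if n = 0 then 1 else 0) + (-1) ^ y * (if m = 0 then 1 else 0) * \<xi> n)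
     / complex_of_real (sqrt (noon_norm \<xi> x y)))"

definition prob :: "mode_vec \<Rightarrow> op_mat \<Rightarrow> op_mat \<Rightarrow> nat \<Rightarrow> nat \<Rightarrow> real" where
  "prob \<xi> PA PB x y = expect2 PA PB (beam_splitter (noon \<xi> x y))"

definition gyni :: "mode_vec \<Rightarrow> op_mat \<Rightarrow> op_mat \<Rightarrow> op_mat \<Rightarrow> op_mat \<Rightarrow> real" where
  "gyni \<xi> PA0 PA1 PB0 PB1 =
     (prob \<xi> PA0 PB0 0 0 + prob \<xi> PA0 PB0 1 1 + prob \<xi> PA1 PB1 0 1 + prob \<xi> PA1 PB1 1 0) / 4"

end

theory Submission
  imports Defs
begin

text \<open>
  After the beam splitter the two relevant states are the parts of \<open>U (|\<xi>> |0>)\<close> with even, respectively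
  odd, photon number in mode \<open>B\<close>, each normalised.  If \<open>\<xi>\<close> is coherent, both are products with the same
  factor in mode \<open>A\<close>, so mode \<open>A\<close> carries no information about the inputs and the value is at most \<open>1/2\<close>.

  Conversely, let mode \<open>B\<close> measure its parity.  Absence of a violation then forces the two reduced states of
  mode \<open>A\<close> to coincide.  Let \<open>\<mu> n\<close> be the derivatives at 0 of the rescaled Bargmann function of \<open>\<xi>\<close>,
  put \<open>r = |\<xi> 0|^2\<close>, and for a linear combination \<open>h m = a * \<mu> (m + p) + b * \<mu> m\<close> let \<open>G m = |h m|^2\<close> and
  \<open>g t = (\<Sum>m. G m * t ^ m / m!)\<close>.  Equality of the reduced states says that every derivative of \<open>g\<close> at \<open>-1\<close>
  is \<open>r\<close> times the one at \<open>1\<close>, hence \<open>g t = r * g (t + 2)\<close> for \<open>-1 \<le> t < 0\<close>.  Since \<open>G \<ge> 0\<close>, letting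
  \<open>t\<close> tend to 0 gives \<open>2 * r * G 1 \<le> G 0\<close>, and \<open>G 0 = 0\<close> if \<open>r = 0\<close>.  The latter excludes \<open>r = 0\<close>.  For
  \<open>a = \<mu> 0\<close> and \<open>b = - \<mu> p\<close> we have \<open>G 0 = 0\<close>, so \<open>G 1 = 0\<close>, i.e. \<open>\<mu> 0 * \<mu> (p + 1) = \<mu> p * \<mu> 1\<close>: the
  sequence \<open>\<mu>\<close> is geometric and \<open>\<xi>\<close> is coherent.
\<close>

subsection \<open>Square-summable sequences and projections\<close>

lemma sqnorm_nonneg: "0 \<le> sqnorm v"
  unfolding sqnorm_def by (rule infsum_nonneg) simp

lemma l2_comparison:
  assumes "l2 v" and "\<And>i. cmod (w i) \<le> c * cmod (v i)"
  shows "l2 w"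
proof -
  have "(\<lambda>i. c\<^sup>2 * (cmod (v i))\<^sup>2) summable_on UNIV"
    using assms(1) unfolding l2_def by (rule summable_on_cmult_right)
  then show ?thesis unfolding l2_def
  proof (rule summable_on_comparison_test)
    fix i
    show "(cmod (w i))\<^sup>2 \<le> c\<^sup>2 * (cmod (v i))\<^sup>2"
      using power_mono[OF assms(2)[of i] norm_ge_zero, of 2] by (simp add: power_mult_distrib)
  qed auto
qed

lemma l2_cnj: "l2 v \<Longrightarrow> l2 (\<lambda>i. cnj (v i))"
  by (simp add: l2_def)

lemma sqnorm_cnj: "sqnorm (\<lambda>i. cnj (v i)) = sqnorm v"
  by (simp add: sqnorm_def)

lemma l2_cmult: "l2 v \<Longrightarrow> l2 (\<lambda>i. c * v i)"
  by (rule l2_comparison[of v _ "cmod c"]) (simp_all add: norm_mult)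

lemma sqnorm_cmult: "sqnorm (\<lambda>i. c * v i) = (cmod c)\<^sup>2 * sqnorm v"
  by (simp add: sqnorm_def norm_mult power_mult_distrib infsum_cmult_right')

lemma cmod_diff_square_le: "(cmod (a - b))\<^sup>2 \<le> 2 * (cmod a)\<^sup>2 + 2 * (cmod b)\<^sup>2"
proof -
  have "(cmod (a - b))\<^sup>2 \<le> (cmod a + cmod b)\<^sup>2"
    by (intro power_mono norm_triangle_ineq4) simp
  also have "\<dots> \<le> 2 * (cmod a)\<^sup>2 + 2 * (cmod b)\<^sup>2"
    using sum_squares_bound[of "cmod a" "cmod b"] by (simp add: power2_sum)
  finally show ?thesis .
qed

lemma
  assumes "l2 v" "l2 w"
  shows l2_diff: "l2 (\<lambda>i. v i - w i)"
    and sqnorm_diff_le: "sqnorm (\<lambda>i. v i - w i) \<le> 2 * sqnorm v + 2 * sqnorm w"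
proof -
  have v: "(\<lambda>i. 2 * (cmod (v i))\<^sup>2) summable_on UNIV"
    and w: "(\<lambda>i. 2 * (cmod (w i))\<^sup>2) summable_on UNIV"
    using assms unfolding l2_def by (auto intro: summable_on_cmult_right)
  have s: "(\<lambda>i. 2 * (cmod (v i))\<^sup>2 + 2 * (cmod (w i))\<^sup>2) summable_on UNIV"
    by (rule summable_on_add[OF v w])
  show l: "l2 (\<lambda>i. v i - w i)"
    unfolding l2_def
    by (rule summable_on_comparison_test[OF s]) (use cmod_diff_square_le in auto)
  have "sqnorm (\<lambda>i. v i - w i) \<le> (\<Sum>\<^sub>\<infinity>i. 2 * (cmod (v i))\<^sup>2 + 2 * (cmod (w i))\<^sup>2)"
    unfolding sqnorm_def
    by (rule infsum_mono[OF _ s]) (use l cmod_diff_square_le in \<open>auto simp: l2_def\<close>)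
  also have "\<dots> = 2 * sqnorm v + 2 * sqnorm w"
    unfolding sqnorm_def infsum_add[OF v w] by (simp add: infsum_cmult_right')
  finally show "sqnorm (\<lambda>i. v i - w i) \<le> 2 * sqnorm v + 2 * sqnorm w" .
qed

text \<open>Cauchy-Schwarz on finite sets bounds all partial sums by one constant, which yields both
  the absolute summability and the inequality for the series.\<close>

lemma
  assumes "l2 v" "l2 w"
  shows l2_abs_summable_mult: "(\<lambda>i. norm (v i * w i)) summable_on UNIV"
    and l2_Cauchy_Schwarz: "cmod (\<Sum>\<^sub>\<infinity>i. v i * w i) \<le> sqrt (sqnorm v) * sqrt (sqnorm w)"
proof -
  have fin: "(\<Sum>i\<in>F. (cmod (u i))\<^sup>2) \<le> sqnorm u" if "finite F" "l2 u" for F and u :: "'a \<Rightarrow> complex"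
    unfolding sqnorm_def by (rule finite_sum_le_infsum) (use that in \<open>auto simp: l2_def\<close>)
  have bd: "(\<Sum>i\<in>F. norm (v i * w i)) \<le> sqrt (sqnorm v) * sqrt (sqnorm w)" if F: "finite F" for F
  proof -
    have "(\<Sum>i\<in>F. norm (v i * w i)) = (\<Sum>i\<in>F. \<bar>cmod (v i)\<bar> * \<bar>cmod (w i)\<bar>)"
      by (simp add: norm_mult)
    also have "\<dots> \<le> L2_set (\<lambda>i. cmod (v i)) F * L2_set (\<lambda>i. cmod (w i)) F"
      by (rule L2_set_mult_ineq)
    also have "\<dots> \<le> sqrt (sqnorm v) * sqrt (sqnorm w)"
      unfolding L2_set_def using fin[OF F] assms
      by (intro mult_mono) (auto simp: sqnorm_nonneg sum_nonneg)
    finally show ?thesis .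
  qed
  show s: "(\<lambda>i. norm (v i * w i)) summable_on UNIV"
    by (rule nonneg_bdd_above_summable_on) (use bd in \<open>auto intro!: bdd_aboveI2\<close>)
  have "cmod (\<Sum>\<^sub>\<infinity>i. v i * w i) \<le> (\<Sum>\<^sub>\<infinity>i. norm (v i * w i))"
    by (rule norm_infsum_bound[OF s])
  also have "\<dots> \<le> sqrt (sqnorm v) * sqrt (sqnorm w)"
    by (rule infsum_le_finite_sums[OF s]) (use bd in auto)
  finally show "cmod (\<Sum>\<^sub>\<infinity>i. v i * w i) \<le> sqrt (sqnorm v) * sqrt (sqnorm w)" .
qed

lemmas l2_summable_mult = abs_summable_summable[OF l2_abs_summable_mult]

lemma infsum_diff:
  fixes f g :: "'a \<Rightarrow> 'b::{topological_ab_group_add, t2_space}"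
  assumes "f summable_on A" "g summable_on A"
  shows "(\<Sum>\<^sub>\<infinity>x\<in>A. f x - g x) = infsum f A - infsum g A"
  using infsum_add[OF assms(1) iffD2[OF summable_on_uminus assms(2)]]
  by (simp add: infsum_uminus)

lemma infsum_sum:
  fixes f :: "'i \<Rightarrow> 'a \<Rightarrow> 'b::{topological_comm_monoid_add, t2_space}"
  assumes "\<And>i. i \<in> I \<Longrightarrow> f i summable_on A"
  shows "(\<Sum>\<^sub>\<infinity>x\<in>A. \<Sum>i\<in>I. f i x) = (\<Sum>i\<in>I. infsum (f i) A)"
proof -
  have "((\<lambda>x. \<Sum>i\<in>I. f i x) has_sum (\<Sum>i\<in>I. infsum (f i) A)) A"
    using assms
    by (induction I rule: infinite_finite_induct) (auto intro!: has_sum_add has_sum_infsum)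
  then show ?thesis by (rule infsumI)
qed

section \<open>Inner products\<close>

definition inner_prod :: "('a \<Rightarrow> complex) \<Rightarrow> ('a \<Rightarrow> complex) \<Rightarrow> complex" where
  "inner_prod v w = (\<Sum>\<^sub>\<infinity>i. cnj (v i) * w i)"

lemma inner_prod_self:
  assumes "l2 v"
  shows "inner_prod v v = of_real (sqnorm v)"
proof -
  have "((\<lambda>i. (cmod (v i))\<^sup>2) has_sum sqnorm v) UNIV"
    using assms unfolding l2_def sqnorm_def by (rule has_sum_infsum)
  then have "((\<lambda>i. complex_of_real ((cmod (v i))\<^sup>2)) has_sum of_real (sqnorm v)) UNIV"
    by (rule has_sum_of_real)
  then have "((\<lambda>i. cnj (v i) * v i) has_sum of_real (sqnorm v)) UNIV"
    by (simp only: complex_norm_square mult.commute[of _ "cnj _"])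
  then show ?thesis unfolding inner_prod_def by (rule infsumI)
qed

lemma inner_prod_Cauchy_Schwarz:
  assumes "l2 v" "l2 w"
  shows "cmod (inner_prod v w) \<le> sqrt (sqnorm v) * sqrt (sqnorm w)"
  using l2_Cauchy_Schwarz[OF l2_cnj[OF assms(1)] assms(2)] by (simp add: inner_prod_def sqnorm_cnj)

lemma inner_prod_cmult_right: "inner_prod x (\<lambda>i. c * v i) = c * inner_prod x v"
  by (simp add: inner_prod_def mult.left_commute infsum_cmult_right')

lemma inner_prod_cmult_left: "inner_prod (\<lambda>i. c * x i) v = cnj c * inner_prod x v"
  by (simp add: inner_prod_def mult.assoc infsum_cmult_right')

lemma inner_prod_diff_left:
  assumes "l2 u" "l2 v" "l2 w"
  shows "inner_prod (\<lambda>i. u i - v i) w = inner_prod u w - inner_prod v w"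
  using infsum_diff[OF l2_summable_mult[OF l2_cnj[OF assms(1)] assms(3)]
      l2_summable_mult[OF l2_cnj[OF assms(2)] assms(3)]]
  by (simp add: inner_prod_def left_diff_distrib)

lemma infsum_mult_diff:
  assumes "l2 u" "l2 v" "l2 w"
  shows "(\<Sum>\<^sub>\<infinity>i. u i * (v i - w i)) = (\<Sum>\<^sub>\<infinity>i. u i * v i) - (\<Sum>\<^sub>\<infinity>i. u i * w i)"
  using infsum_diff[OF l2_summable_mult[OF assms(1,2)] l2_summable_mult[OF assms(1,3)]]
  by (simp add: right_diff_distrib)

section \<open>Projections as operators\<close>

lemma is_projectionD:
  assumes "is_projection P"
  shows "l2 (P i)" "P i j = cnj (P j i)" "l2 v \<Longrightarrow> l2 (mat_app P v)"
    "l2 v \<Longrightarrow> mat_app P (mat_app P v) = mat_app P v"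
  using assms unfolding is_projection_def by blast+

lemma mat_app_diff:
  assumes "is_projection P" "l2 v" "l2 w"
  shows "mat_app P (\<lambda>i. v i - w i) = (\<lambda>i. mat_app P v i - mat_app P w i)"
  unfolding mat_app_def by (simp only: infsum_mult_diff[OF is_projectionD(1)[OF assms(1)] assms(2,3)])

lemma is_projection_bounded:
  assumes "is_projection P"
  obtains C where "C \<ge> 0" "\<And>v. l2 v \<Longrightarrow> sqnorm (mat_app P v) \<le> C * sqnorm v"
proof -
  obtain C where C: "\<And>v. l2 v \<Longrightarrow> sqnorm (mat_app P v) \<le> C * sqnorm v"
    using assms unfolding is_projection_def by blast
  have "sqnorm (mat_app P v) \<le> \<bar>C\<bar> * sqnorm v" if "l2 v" for v
    using C[OF that] mult_right_mono[OF abs_ge_self[of C] sqnorm_nonneg[of v]] by linarith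
  then show thesis using that[of "\<bar>C\<bar>"] by simp
qed

text \<open>The double series over \<open>i\<close> and \<open>j\<close> need not converge absolutely, so the two summations
  are exchanged for truncations of \<open>f\<close>, and boundedness of \<open>P\<close> handles the limit.\<close>

lemma projection_self_adjoint:
  assumes P: "is_projection P" and f: "l2 f" and h: "l2 h"
  shows "inner_prod f (mat_app P h) = inner_prod (mat_app P f) h"
proof -
  obtain C where C: "C \<ge> 0" "\<And>v. l2 v \<Longrightarrow> sqnorm (mat_app P v) \<le> C * sqnorm v"
    using is_projection_bounded[OF P] by blast
  define t where "t N = (\<lambda>i. if i < N then f i else 0)" for N :: nat
  define d where "d N = (\<lambda>i. f i - t N i)" for N
  have lt: "l2 (t N)" for N
    by (rule l2_comparison[OF f, of _ 1]) (simp add: t_def)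
  have ld: "l2 (d N)" for N
    unfolding d_def by (rule l2_diff[OF f lt])
  have Ph: "l2 (mat_app P h)" by (rule is_projectionD(3)[OF P h])
  have fs: "(\<lambda>i. (cmod (f i))\<^sup>2) sums sqnorm f"
    using f unfolding l2_def sqnorm_def by (intro has_sum_imp_sums has_sum_infsum)
  have sd: "sqnorm (d N) = sqnorm f - (\<Sum>i<N. (cmod (f i))\<^sup>2)" for N
  proof -
    have "((\<lambda>i. (cmod (f i))\<^sup>2 - (if i < N then (cmod (f i))\<^sup>2 else 0)) sums
            (sqnorm f - (\<Sum>i<N. (cmod (f i))\<^sup>2)))"
      using sums_diff[OF fs sums_If_finite_set[of "{..<N}" "\<lambda>i. (cmod (f i))\<^sup>2"]] by simp
    moreover have "(\<lambda>i. (cmod (f i))\<^sup>2 - (if i < N then (cmod (f i))\<^sup>2 else 0)) = (\<lambda>i. (cmod (d N i))\<^sup>2)"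
      by (auto simp: d_def t_def)
    moreover have "(\<lambda>i. (cmod (d N i))\<^sup>2) sums sqnorm (d N)"
      using ld unfolding l2_def sqnorm_def by (intro has_sum_imp_sums has_sum_infsum)
    ultimately show ?thesis by (simp add: sums_iff)
  qed
  have d0: "(\<lambda>N. sqnorm (d N)) \<longlonglongrightarrow> 0"
    using tendsto_diff[OF tendsto_const[of "sqnorm f"] fs[unfolded sums_def]] unfolding sd by simp
  have trunc: "inner_prod (t N) (mat_app P h) = inner_prod (mat_app P (t N)) h" for N
  proof -
    have row: "(\<lambda>j. cnj (f i) * (P i j * h j)) summable_on UNIV" for i
      by (rule summable_on_cmult_right[OF l2_summable_mult[OF is_projectionD(1)[OF P] h]])
    have app: "mat_app P (t N) j = (\<Sum>i<N. P j i * f i)" for j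
    proof -
      have "mat_app P (t N) j = (\<Sum>\<^sub>\<infinity>i\<in>{..<N}. P j i * f i)"
        unfolding mat_app_def by (rule infsum_cong_neutral) (auto simp: t_def)
      then show ?thesis by simp
    qed
    have "inner_prod (t N) (mat_app P h) = (\<Sum>\<^sub>\<infinity>i\<in>{..<N}. cnj (f i) * mat_app P h i)"
      unfolding inner_prod_def by (rule infsum_cong_neutral) (auto simp: t_def)
    also have "\<dots> = (\<Sum>i<N. \<Sum>\<^sub>\<infinity>j. cnj (f i) * (P i j * h j))"
      by (simp add: mat_app_def infsum_cmult_right')
    also have "\<dots> = (\<Sum>\<^sub>\<infinity>j. \<Sum>i<N. cnj (f i) * (P i j * h j))"
      by (rule infsum_sum[symmetric]) (rule row)
    also have "\<dots> = inner_prod (mat_app P (t N)) h"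
      unfolding inner_prod_def app
      by (intro infsum_cong) (simp add: sum_distrib_left is_projectionD(2)[OF P, symmetric] mult_ac)
    finally show ?thesis .
  qed
  have lim: "(\<lambda>N. inner_prod (t N) w) \<longlonglongrightarrow> inner_prod f w" if w: "l2 w" for w
  proof -
    have "(\<lambda>N. inner_prod (d N) w) \<longlonglongrightarrow> 0"
    proof (rule Lim_null_comparison)
      show "\<forall>\<^sub>F N in sequentially. cmod (inner_prod (d N) w) \<le> sqrt (sqnorm (d N)) * sqrt (sqnorm w)"
        using inner_prod_Cauchy_Schwarz[OF ld w] by simp
      show "(\<lambda>N. sqrt (sqnorm (d N)) * sqrt (sqnorm w)) \<longlonglongrightarrow> 0"
        using tendsto_mult_right[OF tendsto_real_sqrt[OF d0]] by simp
    qed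
    then have "(\<lambda>N. inner_prod f w - inner_prod (t N) w) \<longlonglongrightarrow> 0"
      using inner_prod_diff_left[OF f lt w] by (simp add: d_def)
    from tendsto_diff[OF tendsto_const[of "inner_prod f w"] this] show ?thesis by simp
  qed
  have lim2: "(\<lambda>N. inner_prod (mat_app P (t N)) h) \<longlonglongrightarrow> inner_prod (mat_app P f) h"
  proof -
    have "(\<lambda>N. inner_prod (mat_app P (d N)) h) \<longlonglongrightarrow> 0"
    proof (rule Lim_null_comparison)
      have "cmod (inner_prod (mat_app P (d N)) h) \<le> sqrt (C * sqnorm (d N)) * sqrt (sqnorm h)" for N
        using inner_prod_Cauchy_Schwarz[OF is_projectionD(3)[OF P ld[of N]] h]
          mult_right_mono[OF real_sqrt_le_mono[OF C(2)[OF ld[of N]]], of "sqrt (sqnorm h)"]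
        by (simp add: sqnorm_nonneg)
      then show "\<forall>\<^sub>F N in sequentially. cmod (inner_prod (mat_app P (d N)) h)
          \<le> sqrt (C * sqnorm (d N)) * sqrt (sqnorm h)"
        by simp
      show "(\<lambda>N. sqrt (C * sqnorm (d N)) * sqrt (sqnorm h)) \<longlonglongrightarrow> 0"
        using tendsto_mult_right[OF tendsto_real_sqrt[OF tendsto_mult_left[OF d0, of C]]] by simp
    qed
    then have "(\<lambda>N. inner_prod (mat_app P f) h - inner_prod (mat_app P (t N)) h) \<longlonglongrightarrow> 0"
      using inner_prod_diff_left[OF is_projectionD(3)[OF P f] is_projectionD(3)[OF P lt] h]
      by (simp add: d_def mat_app_diff[OF P f lt])
    from tendsto_diff[OF tendsto_const[of "inner_prod (mat_app P f) h"] this] show ?thesis by simp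
  qed
  show ?thesis
    using LIMSEQ_unique[OF lim[OF Ph] lim2[folded trunc]] .
qed

text \<open>Write \<open>P f\<close> as \<open>P (P f)\<close> and move one factor to the left by
  self-adjointness. Probabilities thus become squared norms.\<close>

lemma projection_expectation:
  assumes "is_projection P" "l2 f"
  shows "inner_prod f (mat_app P f) = of_real (sqnorm (mat_app P f))"
  using projection_self_adjoint[OF assms is_projectionD(3)[OF assms]]
    inner_prod_self[OF is_projectionD(3)[OF assms]]
  by (simp add: is_projectionD(4)[OF assms])

text \<open>The squared norms are the expectations of \<open>P0\<close> and \<open>P1\<close> in
  \<open>f\<close>, and these add up to \<open>inner_prod f f\<close> because the matrices sum to
  the identity.\<close>

lemma two_outcome_pvm_sqnorm:
  assumes pvm: "two_outcome_pvm P0 P1" and f: "l2 f"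
  shows "sqnorm (mat_app P0 f) + sqnorm (mat_app P1 f) = sqnorm f"
proof -
  have P: "is_projection P0" "is_projection P1" "\<And>i j. P0 i j + P1 i j = (if i = j then 1 else 0)"
    using pvm by (auto simp: two_outcome_pvm_def)
  have sum: "mat_app P0 f i + mat_app P1 f i = f i" for i
  proof -
    have "mat_app P0 f i + mat_app P1 f i = (\<Sum>\<^sub>\<infinity>j. P0 i j * f j + P1 i j * f j)"
      unfolding mat_app_def
      by (intro infsum_add[symmetric] l2_summable_mult f is_projectionD(1)[OF P(1)] is_projectionD(1)[OF P(2)])
    also have "\<dots> = (\<Sum>\<^sub>\<infinity>j\<in>{i}. f j)"
      by (rule infsum_cong_neutral) (auto simp: P(3) simp flip: distrib_right)
    finally show ?thesis by simp
  qed
  have "complex_of_real (sqnorm (mat_app P0 f) + sqnorm (mat_app P1 f)) =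
      inner_prod f (mat_app P0 f) + inner_prod f (mat_app P1 f)"
    by (simp add: projection_expectation P f)
  also have "\<dots> = (\<Sum>\<^sub>\<infinity>i. cnj (f i) * mat_app P0 f i + cnj (f i) * mat_app P1 f i)"
    unfolding inner_prod_def
    by (intro infsum_add[symmetric] l2_summable_mult l2_cnj f is_projectionD(3)[OF P(1)] is_projectionD(3)[OF P(2)])
  also have "\<dots> = inner_prod f f"
    by (simp add: inner_prod_def sum flip: distrib_left)
  also have "\<dots> = of_real (sqnorm f)" by (rule inner_prod_self[OF f])
  finally show ?thesis by (simp only: of_real_eq_iff)
qed

subsection \<open>Rank-one and parity projections\<close>

lemma mat_app_complement:
  assumes "is_projection P" "l2 v"
  shows "mat_app (\<lambda>i j. (if i = j then 1 else 0) - P i j) v = (\<lambda>i. v i - mat_app P v i)"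
proof
  fix i
  have neutral: "(\<Sum>\<^sub>\<infinity>j. (if i = j then 1 else 0) * v j) = (\<Sum>\<^sub>\<infinity>j\<in>{i}. v j)"
    by (rule infsum_cong_neutral) auto
  have "(\<lambda>j. (if i = j then 1 else 0) * v j) summable_on UNIV"
    by (rule finite_nonzero_values_imp_summable_on) (rule finite_subset[of _ "{i}"], auto)
  from infsum_diff[OF this l2_summable_mult[OF is_projectionD(1)[OF assms(1), of i] assms(2)]] neutral
  show "mat_app (\<lambda>i j. (if i = j then 1 else 0) - P i j) v i = v i - mat_app P v i"
    by (simp add: mat_app_def left_diff_distrib)
qed

lemma l2_finite_support:
  assumes "finite S" "\<And>i. i \<notin> S \<Longrightarrow> v i = 0"
  shows "l2 v"
  unfolding l2_def
  by (rule finite_nonzero_values_imp_summable_on) (rule finite_subset[of _ S], use assms in auto)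

lemma l2_indicator: "l2 (\<lambda>j. if i = j then 1 else 0)"
  by (rule l2_finite_support[of "{i}"]) auto

lemma is_projection_complement:
  assumes P: "is_projection P"
  shows "is_projection (\<lambda>i j. (if i = j then 1 else 0) - P i j)" (is "is_projection ?Q")
proof -
  obtain C where C: "C \<ge> 0" "\<And>v. l2 v \<Longrightarrow> sqnorm (mat_app P v) \<le> C * sqnorm v"
    using is_projection_bounded[OF P] by blast
  have l: "l2 (mat_app ?Q v)" if "l2 v" for v
    unfolding mat_app_complement[OF P that] by (rule l2_diff[OF that is_projectionD(3)[OF P that]])
  \<comment> \<open>The crude constant comes from \<open>sqnorm_diff_le\<close>; any bound will
    do.\<close>
  have b: "sqnorm (mat_app ?Q v) \<le> (2 + 2 * C) * sqnorm v" if "l2 v" for v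
    unfolding mat_app_complement[OF P that]
    using sqnorm_diff_le[OF that is_projectionD(3)[OF P that]] C(2)[OF that]
    by (simp add: algebra_simps)
  have i: "mat_app ?Q (mat_app ?Q v) = mat_app ?Q v" if v: "l2 v" for v
    unfolding mat_app_complement[OF P l[OF v]]
    unfolding mat_app_complement[OF P v]
    unfolding mat_app_diff[OF P v is_projectionD(3)[OF P v]] is_projectionD(4)[OF P v]
    by simp
  have h: "?Q i j = cnj (?Q j i)" for i j
    by (simp flip: is_projectionD(2)[OF P, of i j])
  have r: "l2 (?Q i)" for i
    by (rule l2_diff[OF l2_indicator is_projectionD(1)[OF P]])
  show ?thesis
    unfolding is_projection_def using r h l b i by blast
qed

lemma two_outcome_pvm_complement:
  assumes "is_projection P"
  shows "two_outcome_pvm P (\<lambda>i j. (if i = j then 1 else 0) - P i j)"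
    and "two_outcome_pvm (\<lambda>i j. (if i = j then 1 else 0) - P i j) P"
  using assms is_projection_complement[OF assms] by (simp_all add: two_outcome_pvm_def)

definition ket_bra :: "mode_vec \<Rightarrow> op_mat" where
  "ket_bra x i j = x i * cnj (x j)"

lemma mat_app_ket_bra: "mat_app (ket_bra x) v = (\<lambda>i. inner_prod x v * x i)"
  by (simp add: mat_app_def ket_bra_def inner_prod_def mult.assoc infsum_cmult_right' mult.commute[of _ "x i" for i])

lemma is_projection_ket_bra:
  assumes x: "l2 x" "sqnorm x = 1"
  shows "is_projection (ket_bra x)"
proof -
  have r: "l2 (ket_bra x i)" for i
    unfolding ket_bra_def by (rule l2_cmult[OF l2_cnj[OF x(1)]])
  have b: "sqnorm (mat_app (ket_bra x) v) \<le> 1 * sqnorm v" if "l2 v" for v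
  proof -
    have "(cmod (inner_prod x v))\<^sup>2 \<le> (sqrt (sqnorm x) * sqrt (sqnorm v))\<^sup>2"
      by (rule power_mono[OF inner_prod_Cauchy_Schwarz[OF x(1) that]]) simp
    then show ?thesis
      by (simp add: mat_app_ket_bra sqnorm_cmult x sqnorm_nonneg)
  qed
  have i: "mat_app (ket_bra x) (mat_app (ket_bra x) v) = mat_app (ket_bra x) v" for v
    by (simp add: mat_app_ket_bra inner_prod_cmult_right inner_prod_self[OF x(1)] x(2))
  have l: "l2 (mat_app (ket_bra x) v)" for v
    unfolding mat_app_ket_bra by (rule l2_cmult[OF x(1)])
  have h: "ket_bra x i j = cnj (ket_bra x j i)" for i j
    by (simp add: ket_bra_def)
  show ?thesis
    unfolding is_projection_def using r h l b i by blast
qed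

text \<open>The index matches that of \<open>out_state\<close>: the vector
  \<open>out_state \<xi> s\<close> lives where \<open>s + q\<close> is even, so on mode B this
  measurement reveals \<open>x + y\<close> modulo 2.\<close>

definition parity_proj :: "nat \<Rightarrow> op_mat" where
  "parity_proj s i j = (if i = j \<and> even (s + i) then 1 else 0)"

lemma mat_app_parity_proj: "mat_app (parity_proj s) v = (\<lambda>i. if even (s + i) then v i else 0)"
proof
  fix i
  have "mat_app (parity_proj s) v i = (\<Sum>\<^sub>\<infinity>j\<in>{i}. if even (s + i) then v j else 0)"
    unfolding mat_app_def by (rule infsum_cong_neutral) (auto simp: parity_proj_def)
  then show "mat_app (parity_proj s) v i = (if even (s + i) then v i else 0)" by simp
qed

lemma is_projection_parity_proj: "is_projection (parity_proj s)"
proof -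
  have r: "l2 (parity_proj s i)" for i
    by (rule l2_comparison[OF l2_indicator[of i], of _ 1]) (auto simp: parity_proj_def)
  have l: "l2 (mat_app (parity_proj s) v)" if "l2 v" for v
    by (rule l2_comparison[OF that, of _ 1]) (auto simp: mat_app_parity_proj)
  have b: "sqnorm (mat_app (parity_proj s) v) \<le> 1 * sqnorm v" if "l2 v" for v
    unfolding sqnorm_def mult_1
    by (rule infsum_mono) (use l[OF that] that in \<open>auto simp: l2_def mat_app_parity_proj\<close>)
  have i: "mat_app (parity_proj s) (mat_app (parity_proj s) v) = mat_app (parity_proj s) v" for v
    by (auto simp: mat_app_parity_proj)
  have h: "parity_proj s i j = cnj (parity_proj s j i)" for i j
    by (auto simp: parity_proj_def)
  show ?thesis
    unfolding is_projection_def using r h l b i by blast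
qed

lemma two_outcome_pvm_parity: "two_outcome_pvm (parity_proj 0) (parity_proj 1)"
  unfolding two_outcome_pvm_def by (simp add: is_projection_parity_proj) (simp add: parity_proj_def)

subsection \<open>The state behind the beam splitter\<close>

lemma bij_betw_antidiagonals:
  "bij_betw (\<lambda>(n, p). (p, n - p)) (SIGMA n:UNIV. {..n}) (UNIV :: (nat \<times> nat) set)"
  by (rule bij_betw_byWitness[where f' = "\<lambda>(p, q). (p + q, p)"]) auto

text \<open>Groups a double series by \<open>p + q\<close>: by total photon number for the norm of
  the output state, and by powers of a binomial in \<open>infsum_exponential_shift\<close>.\<close>

lemma
  fixes f :: "nat \<times> nat \<Rightarrow> 'a::banach"
  assumes "(\<lambda>n. \<Sum>p\<le>n. norm (f (p, n - p))) summable_on UNIV"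
  shows antidiagonal_abs_summable: "(\<lambda>z. norm (f z)) summable_on UNIV"
    and antidiagonal_infsum: "infsum f UNIV = (\<Sum>\<^sub>\<infinity>n. \<Sum>p\<le>n. f (p, n - p))"
proof -
  let ?g = "\<lambda>(n, p). (p, n - p)" and ?S = "SIGMA n:(UNIV::nat set). {..n}"
  have "(\<lambda>z. norm (f (?g z))) summable_on ?S"
    unfolding Infinite_Sum.abs_summable_on_Sigma_iff using assms by (simp add: sum_nonneg)
  then show s: "(\<lambda>z. norm (f z)) summable_on UNIV"
    using summable_on_reindex_bij_betw[OF bij_betw_antidiagonals, of "\<lambda>z. norm (f z)"] by simp
  have "(\<lambda>z. f (?g z)) summable_on ?S"
    using abs_summable_summable[OF s] summable_on_reindex_bij_betw[OF bij_betw_antidiagonals, of f] by simp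
  from infsum_Sigma_banach[OF this]
  show "infsum f UNIV = (\<Sum>\<^sub>\<infinity>n. \<Sum>p\<le>n. f (p, n - p))"
    using infsum_reindex_bij_betw[OF bij_betw_antidiagonals, of f] by simp
qed

text \<open>The amplitude of |p,q> in U(|\<xi>>|0>): the beam splitter distributes the n photons of
  |n,0> binomially.\<close>

definition split_amp :: "mode_vec \<Rightarrow> nat \<Rightarrow> nat \<Rightarrow> complex" where
  "split_amp \<xi> p q = \<xi> (p + q) * of_real (sqrt (real (p + q choose p) / 2 ^ (p + q)))"

text \<open>The output for the inputs \<open>x = 0\<close>, \<open>y = s\<close>. The sign factor is
  2 or 0 and selects the photon numbers \<open>q\<close> with the parity of
  \<open>s\<close>.\<close>

definition out_state :: "mode_vec \<Rightarrow> nat \<Rightarrow> twomode_vec" where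
  "out_state \<xi> s = (\<lambda>(p, q). (1 + (-1) ^ (s + q)) * split_amp \<xi> p q / of_real (sqrt (noon_norm \<xi> 0 s)))"

lemma binomial_sqrt_identity:
  "real (p + q choose p) * (sqrt (fact p * fact q) / (sqrt (2 ^ (p + q)) * sqrt (fact (p + q))))
     = sqrt (real (p + q choose p) / 2 ^ (p + q))"
proof -
  have "real (p + q choose p) * (fact p * fact q) = fact (p + q)"
    using binomial_fact_lemma[of p "p + q"]
    by (metis add_diff_cancel_left' le_add1 mult.commute of_nat_fact of_nat_mult)
  then have "sqrt (fact (p + q)) = sqrt (real (p + q choose p)) * sqrt (fact p * fact q)"
    by (metis real_sqrt_mult)
  moreover have "real (p + q choose p) = sqrt (real (p + q choose p)) * sqrt (real (p + q choose p))"
    by simp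
  ultimately show ?thesis
    by (simp add: real_sqrt_divide field_simps)
qed

text \<open>With one input mode empty, a single term of the double sum in \<open>bs_coeff\<close>
  survives. The sign stems from the minus in (a^+ - b^+)^(p+q).\<close>

lemma
  shows bs_coeff_left: "bs_coeff p q (p + q) 0 = of_real (sqrt (real (p + q choose p) / 2 ^ (p + q)))"
    and bs_coeff_right: "bs_coeff p q 0 (p + q) = (-1) ^ q * of_real (sqrt (real (p + q choose p) / 2 ^ (p + q)))"
proof -
  have "(\<Sum>j\<le>p + q. \<Sum>k\<le>(0::nat). if j + k = p
          then of_nat (p + q choose j) * of_nat (0 choose k) * (-1) ^ (0 - k) else 0) = complex_of_nat (p + q choose p)"
    by (simp add: if_distrib sum.delta cong: if_cong)
  then show "bs_coeff p q (p + q) 0 = of_real (sqrt (real (p + q choose p) / 2 ^ (p + q)))"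
    unfolding bs_coeff_def binomial_sqrt_identity[symmetric] by simp
  have "(\<Sum>j\<le>(0::nat). \<Sum>k\<le>p + q. if j + k = p
          then of_nat (0 choose j) * of_nat (p + q choose k) * (-1) ^ (p + q - k) else 0) =
        complex_of_nat (p + q choose p) * (-1) ^ q"
    by (simp add: if_distrib sum.delta cong: if_cong)
  then show "bs_coeff p q 0 (p + q) = (-1) ^ q * of_real (sqrt (real (p + q choose p) / 2 ^ (p + q)))"
    unfolding bs_coeff_def binomial_sqrt_identity[symmetric] by simp
qed

lemma beam_splitter_noon:
  "beam_splitter (noon \<xi> x y) = (\<lambda>(p, q).
     ((-1) ^ x + (-1) ^ (y + q)) * split_amp \<xi> p q / of_real (sqrt (noon_norm \<xi> x y)))"
proof (intro ext, clarify)
  fix p q :: nat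
  let ?N = "p + q" and ?d = "complex_of_real (sqrt (noon_norm \<xi> x y))"
  have "beam_splitter (noon \<xi> x y) (p, q) =
      (\<Sum>m\<le>?N. (if m = ?N then (-1) ^ x * bs_coeff p q ?N 0 * \<xi> ?N / ?d else 0) +
               (if m = 0 then (-1) ^ y * bs_coeff p q 0 ?N * \<xi> ?N / ?d else 0))"
    unfolding beam_splitter_def noon_def
    by (simp only: prod.case) (rule sum.cong[OF refl], auto simp: field_simps add_divide_distrib)
  also have "\<dots> = ((-1) ^ x + (-1) ^ (y + q)) * split_amp \<xi> p q / ?d"
    by (simp add: sum.distrib bs_coeff_left bs_coeff_right split_amp_def power_add
        field_simps add_divide_distrib)
  finally show "beam_splitter (noon \<xi> x y) (p, q) = ((-1) ^ x + (-1) ^ (y + q)) * split_amp \<xi> p q / ?d" .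
qed

lemma expect2_uminus: "expect2 P Q (\<lambda>z. - \<Phi> z) = expect2 P Q \<Phi>"
proof -
  have "tensor_app P Q (\<lambda>z. - \<Phi> z) = (\<lambda>z. - tensor_app P Q \<Phi> z)"
    by (auto simp: tensor_app_def infsum_uminus)
  then show ?thesis by (simp add: expect2_def)
qed

text \<open>Flipping both inputs only changes the global sign of the state, so the four
  probabilities agree in pairs.\<close>

lemma gyni_eq:
  "gyni \<xi> PA0 PA1 PB0 PB1 =
     (expect2 PA0 PB0 (out_state \<xi> 0) + expect2 PA1 PB1 (out_state \<xi> 1)) / 2"
proof -
  have n: "noon_norm \<xi> (Suc 0) (Suc 0) = noon_norm \<xi> 0 0" "noon_norm \<xi> (Suc 0) 0 = noon_norm \<xi> 0 (Suc 0)"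
    by (simp_all add: noon_norm_def)
  have 00: "beam_splitter (noon \<xi> 0 0) = out_state \<xi> 0"
    and 01: "beam_splitter (noon \<xi> 0 1) = out_state \<xi> 1"
    by (simp_all add: beam_splitter_noon out_state_def)
  have 11: "beam_splitter (noon \<xi> 1 1) = (\<lambda>z. - out_state \<xi> 0 z)"
    and 10: "beam_splitter (noon \<xi> 1 0) = (\<lambda>z. - out_state \<xi> 1 z)"
    by (auto simp: fun_eq_iff beam_splitter_noon out_state_def n algebra_simps minus_divide_left)
  show ?thesis
    by (simp add: gyni_def prob_def 00[simplified] 01[simplified] 10[simplified] 11[simplified] expect2_uminus)
qed

text \<open>Since \<open>1 + (-1) ^ k\<close> is 0 or 2, its square is linear in the sign. Hence
  only plain and alternating sums over \<open>q\<close> occur later.\<close>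

lemma cmod_parity_factor:
  assumes "cmod (\<xi> 0) < 1"
  shows "(cmod ((1 + (-1) ^ (s + q)) / of_real (sqrt (noon_norm \<xi> 0 s))))\<^sup>2 =
    (1 + (-1) ^ (s + q)) / (1 + (-1) ^ s * (cmod (\<xi> 0))\<^sup>2)"
proof -
  have r: "(cmod (\<xi> 0))\<^sup>2 < 1"
    using assms by (simp add: power_less_one_iff abs_square_less_1)
  have N: "noon_norm \<xi> 0 s > 0"
    using r zero_le_power2[of "cmod (\<xi> 0)"] by (cases "even s") (simp_all add: noon_norm_def add_pos_nonneg)
  have e: "cmod (1 + (-1) ^ (s + q)) ^ 2 = 2 * (1 + (-1) ^ (s + q))"
    by (cases "even (s + q)") simp_all
  have "(cmod ((1 + (-1) ^ (s + q)) / of_real (sqrt (noon_norm \<xi> 0 s))))\<^sup>2 =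
      cmod (1 + (-1) ^ (s + q)) ^ 2 / noon_norm \<xi> 0 s"
    using N by (simp add: norm_divide power_divide)
  then show ?thesis unfolding e by (simp add: noon_norm_def del: distrib_left_numeral)
qed

lemma out_state_eq:
  "out_state \<xi> s (p, q) = (1 + (-1) ^ (s + q)) / of_real (sqrt (noon_norm \<xi> 0 s)) * split_amp \<xi> p q"
  by (simp add: out_state_def)

lemma
  assumes "l2 \<xi>" and "sqnorm \<xi> = 1" and lt: "cmod (\<xi> 0) < 1"
  shows l2_out_state: "l2 (out_state \<xi> s)"
    and sqnorm_out_state: "sqnorm (out_state \<xi> s) = 1"
proof -
  let ?r = "(cmod (\<xi> 0))\<^sup>2" and ?f = "\<lambda>z. (cmod (out_state \<xi> s z))\<^sup>2"
  have r: "?r < 1"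
    using lt by (simp add: power_less_one_iff abs_square_less_1)
  have D: "1 + (-1) ^ s * ?r > 0"
    using r zero_le_power2[of "cmod (\<xi> 0)"] by (cases "even s") (simp_all add: add_pos_nonneg)
  \<comment> \<open>At total photon number \<open>n\<close> the plain binomial sum returns the
    weight of \<open>\<xi> n\<close>, while the alternating one vanishes except for the vacuum. That
    exception accounts for the interference term in \<open>noon_norm\<close>.\<close>
  have diag: "(\<Sum>p\<le>n. ?f (p, n - p)) =
      ((cmod (\<xi> n))\<^sup>2 + (if n = 0 then (-1) ^ s * ?r else 0)) / (1 + (-1) ^ s * ?r)" for n
  proof -
    have b1: "(\<Sum>p\<le>n. real (n choose p)) = 2 ^ n"
      using choose_row_sum[of n] by (metis of_nat_numeral of_nat_power of_nat_sum)
    have b2: "(\<Sum>p\<le>n. (-1) ^ (n - p) * real (n choose p)) = 0 ^ n"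
      using binomial_ring[of 1 "-1::real" n] by (simp add: mult.commute)
    have "(\<Sum>p\<le>n. ?f (p, n - p)) =
        (\<Sum>p\<le>n. ((cmod (\<xi> n))\<^sup>2 / 2 ^ n / (1 + (-1) ^ s * ?r)) *
           (real (n choose p) + (-1) ^ s * ((-1) ^ (n - p) * real (n choose p))))"
      by (rule sum.cong[OF refl])
         (unfold out_state_eq norm_mult power_mult_distrib cmod_parity_factor[of \<xi>, OF lt], unfold power_add, simp add: split_amp_def norm_mult power_mult_distrib field_simps)
    also have "\<dots> = ((cmod (\<xi> n))\<^sup>2 / 2 ^ n / (1 + (-1) ^ s * ?r)) * (2 ^ n + (-1) ^ s * 0 ^ n)"
      by (simp only: sum.distrib b1 b2 flip: sum_distrib_left)
    also have "\<dots> = ((cmod (\<xi> n))\<^sup>2 + (if n = 0 then (-1) ^ s * ?r else 0)) / (1 + (-1) ^ s * ?r)"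
      by (cases "n = 0") (simp_all add: power_0_left, simp add: algebra_simps)
    finally show ?thesis .
  qed
  have x: "((\<lambda>n. (cmod (\<xi> n))\<^sup>2) has_sum 1) UNIV"
    using assms(1,2) unfolding l2_def sqnorm_def by (metis has_sum_infsum)
  have d: "((\<lambda>n. if n = 0 then (-1) ^ s * ?r else 0) has_sum ((-1) ^ s * ?r)) (UNIV :: nat set)"
    by (rule has_sum_finite_neutralI[of "{0}"]) auto
  have sum: "((\<lambda>n. \<Sum>p\<le>n. ?f (p, n - p)) has_sum 1) UNIV"
    using has_sum_divide_const[OF has_sum_add[OF x d], of "1 + (-1) ^ s * ?r"] D
    unfolding diag by simp
  then have s: "(\<lambda>n. \<Sum>p\<le>n. norm (?f (p, n - p))) summable_on UNIV"
    by (auto intro: has_sum_imp_summable)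
  show "l2 (out_state \<xi> s)"
    using antidiagonal_abs_summable[OF s] by (simp add: l2_def)
  show "sqnorm (out_state \<xi> s) = 1"
    unfolding sqnorm_def antidiagonal_infsum[OF s] using sum by (rule infsumI)
qed

subsection \<open>Coherent states\<close>

lemma infsum_times:
  fixes a :: "'a \<Rightarrow> 'c::{banach,real_normed_div_algebra}" and b :: "'b \<Rightarrow> 'c"
  assumes a: "(\<lambda>i. norm (a i)) summable_on UNIV" and b: "(\<lambda>k. norm (b k)) summable_on UNIV"
  shows "(\<Sum>\<^sub>\<infinity>(i, k). a i * b k) = infsum a UNIV * infsum b UNIV"
proof -
  have "(\<lambda>z. norm (case z of (i, k) \<Rightarrow> a i * b k)) summable_on (UNIV \<times> UNIV)"
    unfolding Infinite_Sum.abs_summable_on_Sigma_iff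
    using a b by (auto simp: norm_mult infsum_cmult_right' summable_on_cmult_right infsum_nonneg
        abs_mult intro!: summable_on_cmult_left)
  from infsum_Sigma_banach[OF abs_summable_summable[OF this]]
  show ?thesis by (simp add: infsum_cmult_right' infsum_cmult_left')
qed

lemma tensor_app_product:
  "tensor_app P Q (\<lambda>(i, k). f i * g k) = (\<lambda>(i, k). mat_app P f i * mat_app Q g k)"
proof -
  have "(\<Sum>\<^sub>\<infinity>l. Q k l * (f j * g l)) = f j * mat_app Q g k" for j k
    by (simp add: mat_app_def mult.left_commute infsum_cmult_right')
  then show ?thesis
    by (simp add: tensor_app_def mat_app_def[of P] infsum_cmult_left' flip: mult.assoc)
qed

lemma expect2_product:
  assumes "is_projection P" "is_projection Q" "l2 f" "l2 g"
  shows "expect2 P Q (\<lambda>(i, k). f i * g k) = sqnorm (mat_app P f) * sqnorm (mat_app Q g)"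
proof -
  have "(\<Sum>\<^sub>\<infinity>z. cnj (case z of (i, k) \<Rightarrow> f i * g k) * tensor_app P Q (\<lambda>(i, k). f i * g k) z) =
      (\<Sum>\<^sub>\<infinity>(i, k). (cnj (f i) * mat_app P f i) * (cnj (g k) * mat_app Q g k))"
    unfolding tensor_app_product by (rule infsum_cong) (auto simp: mult_ac)
  also have "\<dots> = inner_prod f (mat_app P f) * inner_prod g (mat_app Q g)"
    unfolding inner_prod_def
    by (rule infsum_times) (intro l2_abs_summable_mult l2_cnj assms is_projectionD(3)[OF assms(1)]
        is_projectionD(3)[OF assms(2)])+
  finally show ?thesis
    unfolding expect2_def by (simp add: projection_expectation assms)
qed

lemma sqnorm_product:
  assumes "l2 f" "l2 g"
  shows "sqnorm (\<lambda>(i, k). f i * g k) = sqnorm f * sqnorm g"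
proof -
  have "sqnorm (\<lambda>(i, k). f i * g k) = (\<Sum>\<^sub>\<infinity>(i, k). (cmod (f i))\<^sup>2 * (cmod (g k))\<^sup>2)"
    unfolding sqnorm_def by (rule infsum_cong) (auto simp: norm_mult power_mult_distrib)
  also have "\<dots> = sqnorm f * sqnorm g"
    unfolding sqnorm_def by (rule infsum_times) (use assms in \<open>auto simp: l2_def\<close>)
  finally show ?thesis .
qed

text \<open>The \<open>n\<close>-th derivative at 0 of the entire function \<open>M z = (\<Sum>n. \<xi> n * (z / sqrt 2) ^ n / sqrt (n!))\<close>.
  In the Bargmann representation the beam splitter sends \<open>\<xi> \<otimes> |0>\<close> to \<open>M (z + w)\<close>.\<close>

definition bargmann_deriv :: "mode_vec \<Rightarrow> nat \<Rightarrow> complex" where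
  "bargmann_deriv \<xi> n = \<xi> n * of_real (sqrt (fact n / 2 ^ n))"

text \<open>Up to the square roots of factorials the amplitudes form a Hankel matrix, which splits
  into a product when \<open>bargmann_deriv \<xi>\<close> is geometric.\<close>

lemma split_amp_eq:
  "split_amp \<xi> p q = bargmann_deriv \<xi> (p + q) / of_real (sqrt (fact p) * sqrt (fact q))"
proof -
  have "sqrt (real (p + q choose p) / 2 ^ (p + q)) = sqrt (fact (p + q) / 2 ^ (p + q)) / (sqrt (fact p) * sqrt (fact q))"
    by (simp add: binomial_fact real_sqrt_divide real_sqrt_mult)
  then show ?thesis
    unfolding split_amp_def bargmann_deriv_def by simp
qed

lemma l2_exponential: "l2 (\<lambda>n. z ^ n / of_real (sqrt (fact n)))"
proof -
  have "summable (\<lambda>n. ((cmod z)\<^sup>2) ^ n / fact n)"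
    using summable_exp[of "(cmod z)\<^sup>2"] by (simp add: field_simps)
  moreover have "(cmod (z ^ n / of_real (sqrt (fact n))))\<^sup>2 = ((cmod z)\<^sup>2) ^ n / fact n" for n
    by (simp add: norm_divide norm_power power_divide flip: power_mult) (simp add: mult.commute)
  ultimately show ?thesis
    unfolding l2_def by (simp add: summable_on_UNIV_nonneg_real_iff)
qed

lemma gyni_coherent_le:
  assumes "l2 \<xi>" "sqnorm \<xi> = 1" "cmod (\<xi> 0) < 1"
    and "is_coherent_state \<xi>" and A: "two_outcome_pvm PA0 PA1" and B: "two_outcome_pvm PB0 PB1"
  shows "gyni \<xi> PA0 PA1 PB0 PB1 \<le> 1 / 2"
proof -
  obtain \<beta> c where \<xi>: "\<xi> = (\<lambda>n. c * coherent \<beta> n)"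
    using assms(4) by (auto simp: is_coherent_state_def)
  \<comment> \<open>The factor of mode A, independent of \<open>s\<close> and not normalised; all
    constants are put into \<open>h s\<close>.\<close>
  define f where "f n = (\<beta> / of_real (sqrt 2)) ^ n / of_real (sqrt (fact n))" for n
  define K where "K = c * of_real (exp (- ((cmod \<beta>) ^ 2) / 2))"
  define h where "h s q = K * (1 + (-1) ^ (s + q)) / of_real (sqrt (noon_norm \<xi> 0 s)) * f q" for s q
  have f: "l2 f"
    unfolding f_def by (rule l2_exponential)
  have h: "l2 (h s)" for s
  proof (rule l2_comparison[OF f])
    fix q
    have "cmod (1 + (-1) ^ (s + q)) \<le> 2"
      by (cases "even (s + q)") auto
    then show "cmod (h s q) \<le> (cmod K * 2 / cmod (of_real (sqrt (noon_norm \<xi> 0 s)))) * cmod (f q)"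
      unfolding h_def norm_mult norm_divide by (intro mult_right_mono divide_right_mono mult_left_mono) auto
  qed
  have "bargmann_deriv \<xi> n = K * (\<beta> / of_real (sqrt 2)) ^ n" for n
    by (simp add: bargmann_deriv_def \<xi> coherent_def K_def real_sqrt_divide real_sqrt_power power_divide)
  then have out: "out_state \<xi> s = (\<lambda>(p, q). f p * h s q)" for s
    by (auto simp: out_state_def split_amp_eq h_def f_def power_add fun_eq_iff mult_ac)
  have nh: "sqnorm f * sqnorm (h s) = 1" for s
    using sqnorm_out_state[OF assms(1-3), of s] sqnorm_product[OF f h] by (simp add: out)
  then have H: "sqnorm (h 1) = sqnorm (h 0)"
    by (metis mult_cancel_left zero_neq_one mult_zero_left)
  have p: "is_projection PA0" "is_projection PA1" "is_projection PB0" "is_projection PB1"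
    using A B by (auto simp: two_outcome_pvm_def)
  have le: "sqnorm (mat_app PB0 (h s)) \<le> sqnorm (h s)" "sqnorm (mat_app PB1 (h s)) \<le> sqnorm (h s)" for s
    using two_outcome_pvm_sqnorm[OF B h[of s]] sqnorm_nonneg[of "mat_app PB0 (h s)"]
      sqnorm_nonneg[of "mat_app PB1 (h s)"] by linarith+
  have "gyni \<xi> PA0 PA1 PB0 PB1 =
      (sqnorm (mat_app PA0 f) * sqnorm (mat_app PB0 (h 0)) +
       sqnorm (mat_app PA1 f) * sqnorm (mat_app PB1 (h 1))) / 2"
    unfolding gyni_eq out by (simp add: expect2_product p f h)
  \<comment> \<open>Bounding both contributions of mode B by the common squared norm of
    \<open>h 0\<close> and \<open>h 1\<close> leaves the total weight of the two outcomes on mode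
    A.\<close>
  also have "\<dots> \<le> (sqnorm (mat_app PA0 f) * sqnorm (h 0) + sqnorm (mat_app PA1 f) * sqnorm (h 0)) / 2"
    using le(1)[of 0] le(2)[of 1] unfolding H
    by (intro divide_right_mono add_mono mult_left_mono sqnorm_nonneg) auto
  also have "\<dots> = 1 / 2"
    using two_outcome_pvm_sqnorm[OF A f] nh[of 0] by (simp flip: distrib_right)
  finally show ?thesis .
qed

subsection \<open>Parity measurements\<close>

text \<open>Cuts a two-mode vector into slices of fixed photon number in mode B; the swap makes that
  number the outer index of summation.\<close>

lemma l2_pairs_iff:
  "l2 \<Phi> \<longleftrightarrow> (\<forall>k. l2 (\<lambda>i. \<Phi> (i, k))) \<and> (\<lambda>k. sqnorm (\<lambda>i. \<Phi> (i, k))) summable_on UNIV"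
proof -
  have "l2 \<Phi> \<longleftrightarrow> (\<lambda>z. norm ((cmod (\<Phi> (prod.swap z)))\<^sup>2)) summable_on UNIV \<times> UNIV"
    unfolding l2_def using summable_on_reindex_bij_betw[OF bij_swap, of "\<lambda>z. (cmod (\<Phi> z))\<^sup>2"] by simp
  also have "\<dots> \<longleftrightarrow> (\<forall>k. l2 (\<lambda>i. \<Phi> (i, k))) \<and> (\<lambda>k. sqnorm (\<lambda>i. \<Phi> (i, k))) summable_on UNIV"
    unfolding Infinite_Sum.abs_summable_on_Sigma_iff
    by (simp add: l2_def sqnorm_def infsum_nonneg)
  finally show ?thesis .
qed

lemma infsum_pairs:
  fixes f :: "'a \<times> 'b \<Rightarrow> 'c::banach"
  assumes "f summable_on UNIV"
  shows "infsum f UNIV = (\<Sum>\<^sub>\<infinity>k. \<Sum>\<^sub>\<infinity>i. f (i, k))"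
  using infsum_Sigma_banach[of "\<lambda>z. f (prod.swap z)" UNIV "\<lambda>_. UNIV"] assms
    summable_on_reindex_bij_betw[OF bij_swap, of f] infsum_reindex_bij_betw[OF bij_swap, of f]
  by simp

lemma tensor_app_parity:
  assumes "\<forall>i k. odd (s + k) \<longrightarrow> \<Phi> (i, k) = 0"
  shows "tensor_app P (parity_proj s) \<Phi> = (\<lambda>(i, k). mat_app P (\<lambda>j. \<Phi> (j, k)) i)"
proof -
  have "(\<Sum>\<^sub>\<infinity>l. parity_proj s k l * \<Phi> (j, l)) = \<Phi> (j, k)" for j k
    using fun_cong[OF mat_app_parity_proj[of s "\<lambda>l. \<Phi> (j, l)"], of k] assms
    by (auto simp: mat_app_def)
  then show ?thesis by (simp add: tensor_app_def mat_app_def)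
qed

text \<open>The parity projection fixes \<open>\<Phi>\<close>, so what remains is the expectation of
  \<open>P\<close> in the reduced state of mode A, a mixture of the slices.\<close>

lemma
  assumes P: "is_projection P" and \<Phi>: "l2 \<Phi>"
    and supp: "\<forall>i k. odd (s + k) \<longrightarrow> \<Phi> (i, k) = 0"
  shows summable_projected_slices: "(\<lambda>k. sqnorm (mat_app P (\<lambda>j. \<Phi> (j, k)))) summable_on UNIV"
    and expect2_parity: "expect2 P (parity_proj s) \<Phi> = (\<Sum>\<^sub>\<infinity>k. sqnorm (mat_app P (\<lambda>j. \<Phi> (j, k))))"
proof -
  let ?W = "\<lambda>(i, k). mat_app P (\<lambda>j. \<Phi> (j, k)) i"
  have sl: "\<And>k. l2 (\<lambda>i. \<Phi> (i, k))" and ss: "(\<lambda>k. sqnorm (\<lambda>i. \<Phi> (i, k))) summable_on UNIV"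
    using \<Phi> l2_pairs_iff[of \<Phi>] by auto
  obtain C where C: "C \<ge> 0" "\<And>v. l2 v \<Longrightarrow> sqnorm (mat_app P v) \<le> C * sqnorm v"
    using is_projection_bounded[OF P] by blast
  show sW: "(\<lambda>k. sqnorm (mat_app P (\<lambda>j. \<Phi> (j, k)))) summable_on UNIV"
    by (rule summable_on_comparison_test[OF summable_on_cmult_right[OF ss, of C]])
       (use C(2)[OF sl] in \<open>auto simp: sqnorm_nonneg\<close>)
  have W: "l2 ?W"
    using sW is_projectionD(3)[OF P sl] unfolding l2_pairs_iff by simp
  have "(\<Sum>\<^sub>\<infinity>z. cnj (\<Phi> z) * ?W z) = (\<Sum>\<^sub>\<infinity>k. inner_prod (\<lambda>i. \<Phi> (i, k)) (mat_app P (\<lambda>j. \<Phi> (j, k))))"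
    using infsum_pairs[OF l2_summable_mult[OF l2_cnj[OF \<Phi>] W]] by (simp add: inner_prod_def)
  also have "\<dots> = (\<Sum>\<^sub>\<infinity>k. of_real (sqnorm (mat_app P (\<lambda>j. \<Phi> (j, k)))))"
    by (simp add: projection_expectation[OF P sl])
  also have "\<dots> = of_real (\<Sum>\<^sub>\<infinity>k. sqnorm (mat_app P (\<lambda>j. \<Phi> (j, k))))"
    by (rule infsumI[OF has_sum_of_real[OF has_sum_infsum[OF sW]]])
  finally show "expect2 P (parity_proj s) \<Phi> = (\<Sum>\<^sub>\<infinity>k. sqnorm (mat_app P (\<lambda>j. \<Phi> (j, k))))"
    unfolding expect2_def tensor_app_parity[OF supp] by simp
qed

lemma expect2_parity_complement:
  assumes P: "two_outcome_pvm P0 P1" and \<Phi>: "l2 \<Phi>"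
    and supp: "\<forall>i k. odd (s + k) \<longrightarrow> \<Phi> (i, k) = 0"
  shows "expect2 P0 (parity_proj s) \<Phi> + expect2 P1 (parity_proj s) \<Phi> = sqnorm \<Phi>"
proof -
  have p: "is_projection P0" "is_projection P1" using P by (auto simp: two_outcome_pvm_def)
  have sl: "l2 (\<lambda>i. \<Phi> (i, k))" for k using \<Phi> l2_pairs_iff[of \<Phi>] by auto
  have "expect2 P0 (parity_proj s) \<Phi> + expect2 P1 (parity_proj s) \<Phi> =
      (\<Sum>\<^sub>\<infinity>k. sqnorm (mat_app P0 (\<lambda>j. \<Phi> (j, k))) + sqnorm (mat_app P1 (\<lambda>j. \<Phi> (j, k))))"
    unfolding expect2_parity[OF p(1) \<Phi> supp] expect2_parity[OF p(2) \<Phi> supp]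
    by (intro infsum_add[symmetric] summable_projected_slices[OF _ \<Phi> supp] p)
  also have "\<dots> = sqnorm \<Phi>"
    unfolding two_outcome_pvm_sqnorm[OF P sl] unfolding sqnorm_def
    by (rule infsum_pairs[symmetric]) (use \<Phi> in \<open>simp add: l2_def\<close>)
  finally show ?thesis .
qed

subsection \<open>Exponential generating functions\<close>

lemma le_of_le_add_small:
  fixes a b K :: real
  assumes "\<And>e. 0 < e \<Longrightarrow> e \<le> 1 \<Longrightarrow> a \<le> b + e * K"
  shows "a \<le> b"
proof (rule LIMSEQ_le_const)
  show "(\<lambda>n. b + inverse (real (Suc n)) * K) \<longlonglongrightarrow> b"
    using tendsto_add[OF tendsto_const tendsto_mult_right[OF LIMSEQ_inverse_real_of_nat], of b K] by simp
  show "\<exists>N. \<forall>n\<ge>N. a \<le> b + inverse (real (Suc n)) * K"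
    using assms by (simp add: inverse_le_1_iff)
qed

text \<open>The Taylor expansion of \<open>g t = (\<Sum>n. G n * t ^ n / n!)\<close> about
  \<open>\<sigma>\<close>, evaluated at \<open>s + \<sigma>\<close>; the inner series is the
  \<open>k\<close>-th derivative at \<open>\<sigma>\<close>. Summing along antidiagonals gives the
  binomial theorem, and the absolute values sum to \<open>g (s + 1)\<close>, whence the
  hypothesis.\<close>

lemma infsum_exponential_shift:
  fixes G :: "nat \<Rightarrow> real"
  assumes nonneg: "\<And>n. 0 \<le> G n"
    and summ: "(\<lambda>n. G n * (s + 1) ^ n / fact n) summable_on UNIV"
    and s: "0 \<le> s" and \<sigma>: "\<bar>\<sigma>\<bar> = 1"
  shows "(\<Sum>\<^sub>\<infinity>k. s ^ k / fact k * (\<Sum>\<^sub>\<infinity>q. \<sigma> ^ q * (G (k + q) / fact q))) =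
         (\<Sum>\<^sub>\<infinity>n. G n * (s + \<sigma>) ^ n / fact n)"
proof -
  define f where "f = (\<lambda>(k, q). s ^ k / fact k * (\<sigma> ^ q * (G (k + q) / fact q)))"
  have bin: "(\<Sum>k\<le>n. s ^ k / fact k * (\<tau> ^ (n - k) * (G (k + (n - k)) / fact (n - k)))) =
      G n * (s + \<tau>) ^ n / fact n" for n \<tau>
  proof -
    have "G n * (s + \<tau>) ^ n / fact n =
        (\<Sum>k\<le>n. G n / fact n * (real (n choose k) * s ^ k * \<tau> ^ (n - k)))"
      by (simp add: binomial_ring sum_distrib_left sum_divide_distrib)
    also have "\<dots> = (\<Sum>k\<le>n. s ^ k / fact k * (\<tau> ^ (n - k) * (G (k + (n - k)) / fact (n - k))))"
      by (rule sum.cong[OF refl]) (simp add: binomial_fact)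
    finally show ?thesis by simp
  qed
  have "(\<Sum>k\<le>n. norm (f (k, n - k))) = G n * (s + 1) ^ n / fact n" for n
    by (rule trans[OF sum.cong[OF refl] bin[of 1]]) (simp add: f_def abs_mult power_abs s nonneg \<sigma>)
  then have sd: "(\<lambda>n. \<Sum>k\<le>n. norm (f (k, n - k))) summable_on UNIV"
    using summ by simp
  have "f summable_on (UNIV \<times> UNIV)"
    using abs_summable_summable[OF antidiagonal_abs_summable[OF sd]] by simp
  from infsum_Sigma_banach[OF this] have "infsum f UNIV = (\<Sum>\<^sub>\<infinity>k. \<Sum>\<^sub>\<infinity>q. f (k, q))"
    by simp
  also have "\<dots> = (\<Sum>\<^sub>\<infinity>k. s ^ k / fact k * (\<Sum>\<^sub>\<infinity>q. \<sigma> ^ q * (G (k + q) / fact q)))"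
    by (simp only: f_def prod.case infsum_cmult_right')
  finally show ?thesis
    unfolding antidiagonal_infsum[OF sd] unfolding f_def prod.case bin by simp
qed

text \<open>With \<open>g t = (\<Sum>n. G n * t ^ n / n!)\<close> the hypothesis says that all derivatives of \<open>g\<close> at \<open>-1\<close>
  are \<open>r\<close> times those at \<open>1\<close>, hence \<open>g (s - 1) = r * g (s + 1)\<close>.  The point \<open>s = 1\<close> itself may lie
  on the boundary of the disc of convergence and is only reached as a limit.\<close>

lemma exponential_moment_bounds:
  fixes G :: "nat \<Rightarrow> real"
  assumes nonneg: "\<And>n. 0 \<le> G n"
    and summ: "\<And>t. 0 \<le> t \<Longrightarrow> t < 2 \<Longrightarrow> (\<lambda>n. G n * t ^ n / fact n) summable_on UNIV"
    and eq: "\<And>n. (\<Sum>\<^sub>\<infinity>k. (-1) ^ k * (G (n + k) / fact k)) = r * (\<Sum>\<^sub>\<infinity>k. G (n + k) / fact k)"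
    and r: "0 \<le> r"
  shows "2 * r * G 1 \<le> G 0" and "r = 0 \<Longrightarrow> G 0 = 0"
proof -
  define g where "g t = (\<Sum>\<^sub>\<infinity>n. G n * t ^ n / fact n)" for t
  \<comment> \<open>Taken at \<open>s = 1 - e\<close>, where \<open>s - 1 = - e\<close> and
    \<open>s + 1 = 2 - e\<close> stays below 2.\<close>
  have g_eq: "g (- e) = r * g (2 - e)" if e: "0 < e" "e \<le> 1" for e
  proof -
    have "(\<lambda>n. G n * ((1 - e) + 1) ^ n / fact n) summable_on UNIV"
      by (rule summ) (use e in auto)
    note shift = infsum_exponential_shift[OF nonneg this]
    have "g (- e) = (\<Sum>\<^sub>\<infinity>k. (1 - e) ^ k / fact k * (\<Sum>\<^sub>\<infinity>q. (-1) ^ q * (G (k + q) / fact q)))"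
      using shift[of "-1"] e by (simp add: g_def)
    also have "\<dots> = r * (\<Sum>\<^sub>\<infinity>k. (1 - e) ^ k / fact k * (\<Sum>\<^sub>\<infinity>q. 1 ^ q * (G (k + q) / fact q)))"
      unfolding eq by (simp only: mult.left_commute[of _ r] infsum_cmult_right' power_one mult_1)
    also have "\<dots> = r * g (2 - e)"
      using shift[of 1] e by (simp add: g_def)
    finally show ?thesis .
  qed
  have s1: "(\<lambda>n. G n / fact n) summable_on UNIV"
    using summ[of 1] by simp
  \<comment> \<open>Every power \<open>e ^ n\<close> with \<open>n > 0\<close> is at most
    \<open>e\<close>, so all terms but the constant one together contribute at most
    \<open>e * g 1\<close>.\<close>
  have near: "\<bar>g (- e) - G 0\<bar> \<le> e * g 1" if e: "0 < e" "e \<le> 1" for e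
  proof -
    have d: "((\<lambda>n. if n = 0 then G 0 else 0) has_sum G 0) (UNIV :: nat set)"
      by (rule has_sum_finite_neutralI[of "{0}"]) auto
    have "(\<lambda>n. norm (G n * (- e) ^ n / fact n)) summable_on UNIV"
      using summ[of e] e by (simp add: abs_mult power_abs nonneg)
    then have s: "(\<lambda>n. G n * (- e) ^ n / fact n) summable_on UNIV"
      by (rule abs_summable_summable)
    have bd: "norm (G n * (- e) ^ n / fact n - (if n = 0 then G 0 else 0)) \<le> e * (G n / fact n)" for n
    proof (cases n)
      case (Suc m)
      have "e ^ n \<le> e ^ 1"
        using e Suc by (intro power_decreasing) auto
      then have "G n / fact n * e ^ n \<le> G n / fact n * e ^ 1"
        by (intro mult_left_mono) (simp_all add: nonneg)
      then show ?thesis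
        using Suc e by (simp add: abs_mult power_abs nonneg mult.commute)
    qed (use e nonneg in auto)
    have abs: "(\<lambda>n. norm (G n * (- e) ^ n / fact n - (if n = 0 then G 0 else 0))) summable_on UNIV"
      by (rule summable_on_comparison_test[OF summable_on_cmult_right[OF s1, of e]]) (use bd in auto)
    have "g (- e) - G 0 = (\<Sum>\<^sub>\<infinity>n. G n * (- e) ^ n / fact n - (if n = 0 then G 0 else 0))"
      using infsum_diff[OF s has_sum_imp_summable[OF d]] infsumI[OF d] by (simp add: g_def)
    then have "\<bar>g (- e) - G 0\<bar> \<le> (\<Sum>\<^sub>\<infinity>n. norm (G n * (- e) ^ n / fact n - (if n = 0 then G 0 else 0)))"
      using norm_infsum_bound[OF abs] by simp
    also have "\<dots> \<le> (\<Sum>\<^sub>\<infinity>n. e * (G n / fact n))"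
      by (rule infsum_mono[OF abs summable_on_cmult_right[OF s1]]) (use bd in auto)
    finally show ?thesis by (simp only: g_def infsum_cmult_right' power_one mult_1_right)
  qed
  have "2 * r * G 1 \<le> G 0 + e * (g 1 + r * G 1)" if e: "0 < e" "e \<le> 1" for e
  proof -
    \<comment> \<open>By positivity \<open>g (2 - e)\<close> dominates its linear term; the factor 2
      in the claim is the limit of \<open>2 - e\<close>.\<close>
    have "(\<Sum>n\<in>{1}. G n * (2 - e) ^ n / fact n) \<le> g (2 - e)"
      unfolding g_def by (rule finite_sum_le_infsum[OF summ]) (use e nonneg in auto)
    then have "r * (G 1 * (2 - e)) \<le> r * g (2 - e)"
      using r by (intro mult_left_mono) auto
    then show ?thesis
      using near[OF e] g_eq[OF e] by (simp add: algebra_simps abs_le_iff)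
  qed
  then show "2 * r * G 1 \<le> G 0" by (rule le_of_le_add_small)
  show "G 0 = 0" if "r = 0"
  proof -
    have "G 0 \<le> 0 + e * g 1" if e: "0 < e" "e \<le> 1" for e
      using near[OF e] g_eq[OF e] \<open>r = 0\<close> by simp
    then have "G 0 \<le> 0" by (rule le_of_le_add_small)
    then show ?thesis using nonneg[of 0] by simp
  qed
qed

lemma cmod_square_le_sqnorm:
  assumes "l2 v"
  shows "(cmod (v n))\<^sup>2 \<le> sqnorm v"
proof -
  have "(\<Sum>i\<in>{n}. (cmod (v i))\<^sup>2) \<le> sqnorm v"
    unfolding sqnorm_def by (rule finite_sum_le_infsum) (use assms in \<open>auto simp: l2_def\<close>)
  then show ?thesis by simp
qed

text \<open>As \<open>cmod (\<xi> n) \<le> 1\<close>, the terms are at most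
  \<open>p! * (m + p choose m) * a ^ m\<close> with \<open>a = t / 2 < 1\<close>. One term of the
  expansion of \<open>(a + e) ^ (m + p)\<close> turns this into a geometric bound, where
  \<open>e\<close> is half the gap between \<open>a\<close> and 1.\<close>

lemma summable_bargmann_deriv:
  assumes \<xi>: "l2 \<xi>" "sqnorm \<xi> = 1" and t: "0 \<le> t" "t < 2"
  shows "(\<lambda>m. (cmod (bargmann_deriv \<xi> (m + p)))\<^sup>2 * t ^ m / fact m) summable_on UNIV"
proof -
  define a where "a = t / 2"
  define e where "e = (1 - a) / 2"
  have ae: "0 \<le> a" "0 < e" "a + e < 1" using t by (auto simp: a_def e_def field_simps)
  have geo: "(\<lambda>m. (fact p / e ^ p * (a + e) ^ p) * (a + e) ^ m) summable_on UNIV"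
    using ae by (intro summable_on_cmult_right) (auto simp: summable_on_UNIV_nonneg_real_iff intro!: summable_geometric)
  show ?thesis
  proof (rule summable_on_comparison_test[OF geo])
    fix m
    have "real (m + p choose m) * a ^ m * e ^ (m + p - m) \<le> (a + e) ^ (m + p)"
      unfolding binomial_ring by (rule member_le_sum) (use ae in auto)
    then have c: "real (m + p choose m) * a ^ m \<le> (a + e) ^ (m + p) / e ^ p"
      using ae by (simp add: pos_le_divide_eq)
    have "(cmod (bargmann_deriv \<xi> (m + p)))\<^sup>2 * t ^ m / fact m =
        (cmod (\<xi> (m + p)))\<^sup>2 * (fact (m + p) / fact m * a ^ m / 2 ^ p)"
      by (simp add: bargmann_deriv_def norm_mult power_mult_distrib a_def power_divide power_add mult_ac)
    also have "\<dots> \<le> 1 * (fact (m + p) / fact m * a ^ m / 1)"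
      using ae by (intro mult_mono divide_left_mono cmod_square_le_sqnorm[OF \<xi>(1), unfolded \<xi>(2)]) auto
    also have "\<dots> = fact p * (real (m + p choose m) * a ^ m)"
      by (simp add: binomial_fact)
    also have "\<dots> \<le> fact p * ((a + e) ^ (m + p) / e ^ p)"
      by (rule mult_left_mono[OF c]) simp
    finally show "(cmod (bargmann_deriv \<xi> (m + p)))\<^sup>2 * t ^ m / fact m
        \<le> (fact p / e ^ p * (a + e) ^ p) * (a + e) ^ m"
      by (simp add: power_add mult_ac)
  qed (use t in auto)
qed

subsection \<open>States without violation\<close>

lemma out_state_parity: "\<forall>i k. odd (s + k) \<longrightarrow> out_state \<xi> s (i, k) = 0"
  by (auto simp: out_state_eq)

lemma sqnorm_ket_bra:
  assumes "sqnorm x = 1"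
  shows "sqnorm (mat_app (ket_bra x) v) = (cmod (inner_prod x v))\<^sup>2"
  by (simp add: mat_app_ket_bra sqnorm_cmult assms)

context
  fixes \<xi> :: mode_vec
  assumes \<xi>: "l2 \<xi>" "sqnorm \<xi> = 1" "cmod (\<xi> 0) < 1"
    and no_violation: "\<And>PA0 PA1 PB0 PB1. two_outcome_pvm PA0 PA1 \<Longrightarrow> two_outcome_pvm PB0 PB1 \<Longrightarrow>
      gyni \<xi> PA0 PA1 PB0 PB1 \<le> 1 / 2"
begin

text \<open>Measuring parity on mode \<open>B\<close> turns the GYNI value into the success probability of
  discriminating the two reduced states of mode \<open>A\<close>; without violation these must agree.\<close>

lemma reduced_states_agree:
  assumes x: "l2 x" "sqnorm x = 1"
  shows "expect2 (ket_bra x) (parity_proj 0) (out_state \<xi> 0) = expect2 (ket_bra x) (parity_proj 1) (out_state \<xi> 1)"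
proof -
  note P = two_outcome_pvm_complement[OF is_projection_ket_bra[OF x]]
  note compl = expect2_parity_complement[OF P(1) l2_out_state[OF \<xi>] out_state_parity,
      unfolded sqnorm_out_state[OF \<xi>]]
  \<comment> \<open>Taking \<open>ket_bra x\<close> and its complement in both orders gives both
    inequalities, since the probabilities of the two outcomes sum to 1 in each state.\<close>
  show ?thesis
    using no_violation[OF P(1) two_outcome_pvm_parity] no_violation[OF P(2) two_outcome_pvm_parity]
      compl[of 0] compl[of 1]
    unfolding gyni_eq by simp
qed

text \<open>For a unit vector let \<open>T\<close> be the common probability from
  \<open>reduced_states_agree\<close> and \<open>r = |\<xi> 0|^2\<close>. Undoing the normalisation,
  the even terms sum to \<open>(1 + r) / 2 * T\<close> and the odd ones to
  \<open>(1 - r) / 2 * T\<close>; their sum is \<open>T\<close> and their difference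
  \<open>r * T\<close>.\<close>

lemma alternating_split_amp_sum:
  assumes x: "l2 x"
  defines "A \<equiv> \<lambda>k. (cmod (inner_prod x (\<lambda>j. split_amp \<xi> j k)))\<^sup>2"
  shows "(\<Sum>\<^sub>\<infinity>k. (-1) ^ k * A k) = (cmod (\<xi> 0))\<^sup>2 * (\<Sum>\<^sub>\<infinity>k. A k)"
proof -
  define r where "r = (cmod (\<xi> 0))\<^sup>2"
  have r: "0 \<le> r" "r < 1"
    using \<xi>(3) by (simp_all add: r_def power_less_one_iff abs_square_less_1)
  have unit: "(\<Sum>\<^sub>\<infinity>k. (-1) ^ k * (cmod (inner_prod y (\<lambda>j. split_amp \<xi> j k)))\<^sup>2) =
      r * (\<Sum>\<^sub>\<infinity>k. (cmod (inner_prod y (\<lambda>j. split_amp \<xi> j k)))\<^sup>2)" if y: "l2 y" "sqnorm y = 1" for y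
  proof -
    define B where "B k = (cmod (inner_prod y (\<lambda>j. split_amp \<xi> j k)))\<^sup>2" for k
    define T where "T = expect2 (ket_bra y) (parity_proj 0) (out_state \<xi> 0)"
    have sl: "sqnorm (mat_app (ket_bra y) (\<lambda>j. out_state \<xi> s (j, k))) =
        (1 + (-1) ^ (s + k)) / (1 + (-1) ^ s * r) * B k" for s k
      unfolding sqnorm_ket_bra[OF y(2)] out_state_eq inner_prod_cmult_right norm_mult power_mult_distrib
        cmod_parity_factor[of \<xi>, OF \<xi>(3)] B_def r_def ..
    have hs: "((\<lambda>k. (1 + (-1) ^ (s + k)) / (1 + (-1) ^ s * r) * B k) has_sum
        expect2 (ket_bra y) (parity_proj s) (out_state \<xi> s)) UNIV" for s
      using expect2_parity[OF is_projection_ket_bra[OF y] l2_out_state[OF \<xi>] out_state_parity]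
        summable_projected_slices[OF is_projection_ket_bra[OF y] l2_out_state[OF \<xi>] out_state_parity]
      unfolding sl by (simp add: has_sum_iff)
    have half: "d / 2 * (w / d * b) = w / 2 * b" if "d \<noteq> 0" for d w b :: real
      using that by simp
    have nz: "1 + (-1) ^ s * r \<noteq> 0" for s :: nat
      using r by (cases "even s") auto
    have h: "((\<lambda>k. (1 + (-1) ^ (s + k)) / 2 * B k) has_sum
        (1 + (-1) ^ s * r) / 2 * expect2 (ket_bra y) (parity_proj s) (out_state \<xi> s)) UNIV" for s
      using has_sum_cmult_right[OF hs[of s], of "(1 + (-1) ^ s * r) / 2"] by (simp only: half[OF nz])
    have h0: "((\<lambda>k. (1 + (-1) ^ k) / 2 * B k) has_sum (1 + r) / 2 * T) UNIV"
      using h[of 0] by (simp add: T_def)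
    have h1: "((\<lambda>k. (1 - (-1) ^ k) / 2 * B k) has_sum (1 - r) / 2 * T) UNIV"
      using h[of 1] by (simp add: T_def reduced_states_agree[OF y])
    have "(B has_sum T) UNIV"
      using has_sum_add[OF h0 h1] by (simp add: field_simps)
    moreover have "((\<lambda>k. (-1) ^ k * B k) has_sum r * T) UNIV"
      using has_sum_add[OF h0 has_sum_cmult_right[OF h1, of "-1"]] by (simp add: field_simps)
    ultimately have "(\<Sum>\<^sub>\<infinity>k. (-1) ^ k * B k) = r * (\<Sum>\<^sub>\<infinity>k. B k)"
      by (simp add: infsumI)
    then show ?thesis unfolding B_def .
  qed
  show ?thesis
  \<comment> \<open>Both sides scale with the squared norm of \<open>x\<close>, so every nonzero
    \<open>x\<close> reduces to a unit vector.\<close>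
  proof (cases "sqnorm x = 0")
    case True
    then have "x n = 0" for n
      using cmod_square_le_sqnorm[OF x, of n] by simp
    then show ?thesis by (simp add: A_def inner_prod_def)
  next
    case False
    then have pos: "sqnorm x > 0" using sqnorm_nonneg[of x] by simp
    define c where "c = complex_of_real (1 / sqrt (sqnorm x))"
    define K where "K = 1 / sqnorm x"
    have K: "K \<noteq> 0" "K * sqnorm x = 1" using pos by (auto simp: K_def)
    have c: "(cmod c)\<^sup>2 = K"
      using pos by (simp add: c_def K_def norm_divide power_divide)
    have "sqnorm (\<lambda>i. c * x i) = 1"
      by (simp add: sqnorm_cmult c K)
    from unit[OF l2_cmult[OF x] this] show ?thesis
      using K(1) unfolding inner_prod_cmult_left norm_mult power_mult_distrib complex_mod_cnj c
      by (simp add: A_def r_def infsum_cmult_right' mult.left_commute[of _ K])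
  qed
qed

lemma bargmann_deriv_moments:
  fixes a b :: complex and p :: nat
  defines "G \<equiv> \<lambda>m. (cmod (a * bargmann_deriv \<xi> (m + p) + b * bargmann_deriv \<xi> m))\<^sup>2"
  shows "2 * (cmod (\<xi> 0))\<^sup>2 * G 1 \<le> G 0" and "\<xi> 0 = 0 \<Longrightarrow> G 0 = 0"
proof -
  have nonneg: "0 \<le> G m" for m by (simp add: G_def)
  have summ: "(\<lambda>n. G n * t ^ n / fact n) summable_on UNIV" if t: "0 \<le> t" "t < 2" for t
  proof -
    have s: "(\<lambda>m. 2 * (cmod a)\<^sup>2 * ((cmod (bargmann_deriv \<xi> (m + p)))\<^sup>2 * t ^ m / fact m) +
        2 * (cmod b)\<^sup>2 * ((cmod (bargmann_deriv \<xi> (m + 0)))\<^sup>2 * t ^ m / fact m)) summable_on UNIV"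
      by (intro summable_on_add summable_on_cmult_right summable_bargmann_deriv \<xi> t)
    show ?thesis
    proof (rule summable_on_comparison_test[OF s])
      fix m
      have "G m \<le> 2 * (cmod a)\<^sup>2 * (cmod (bargmann_deriv \<xi> (m + p)))\<^sup>2 + 2 * (cmod b)\<^sup>2 * (cmod (bargmann_deriv \<xi> m))\<^sup>2"
        using cmod_diff_square_le[of "a * bargmann_deriv \<xi> (m + p)" "- (b * bargmann_deriv \<xi> m)"]
        by (simp add: G_def norm_mult power_mult_distrib)
      from mult_right_mono[OF this, of "t ^ m / fact m"]
      show "G m * t ^ m / fact m \<le> 2 * (cmod a)\<^sup>2 * ((cmod (bargmann_deriv \<xi> (m + p)))\<^sup>2 * t ^ m / fact m) +
          2 * (cmod b)\<^sup>2 * ((cmod (bargmann_deriv \<xi> (m + 0)))\<^sup>2 * t ^ m / fact m)"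
        using t by (simp add: algebra_simps add_divide_distrib)
    qed (use t nonneg in auto)
  qed
  have eq: "(\<Sum>\<^sub>\<infinity>k. (-1) ^ k * (G (n + k) / fact k)) = (cmod (\<xi> 0))\<^sup>2 * (\<Sum>\<^sub>\<infinity>k. G (n + k) / fact k)" for n
  proof -
    \<comment> \<open>The test vector reads off rows \<open>n + p\<close> and \<open>n\<close> of
      the amplitudes. The weight \<open>sqrt (fact i)\<close> cancels the denominator in
      \<open>split_amp_eq\<close>, and the conjugation in \<open>x\<close> offsets that of
      \<open>inner_prod\<close>. Varying \<open>n\<close> reaches all derivatives.\<close>
    define \<delta> where "\<delta> c i j = (if j = i then c * of_real (sqrt (fact i)) else 0)" for c :: complex and i j :: nat
    define x where "x = (\<lambda>j. cnj (\<delta> a (n + p) j + \<delta> b n j))"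
    have x: "l2 x"
      by (rule l2_finite_support[of "{n, n + p}"]) (auto simp: x_def \<delta>_def)
    have d: "((\<lambda>j. \<delta> c i j * split_amp \<xi> j k) has_sum
        c * bargmann_deriv \<xi> (i + k) / of_real (sqrt (fact k))) UNIV" for c i k
      by (rule has_sum_finite_neutralI[of "{i}"]) (auto simp: \<delta>_def split_amp_eq)
    have "inner_prod x (\<lambda>j. split_amp \<xi> j k) =
        (a * bargmann_deriv \<xi> (n + k + p) + b * bargmann_deriv \<xi> (n + k)) / of_real (sqrt (fact k))" for k
      using infsumI[OF has_sum_add[OF d[of a "n + p" k] d[of b n k]]]
      by (simp add: inner_prod_def x_def distrib_right add_divide_distrib add_ac)
    then have "(cmod (inner_prod x (\<lambda>j. split_amp \<xi> j k)))\<^sup>2 = G (n + k) / fact k" for k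
      by (simp add: G_def norm_divide power_divide)
    then show ?thesis
      using alternating_split_amp_sum[OF x] by simp
  qed
  show "2 * (cmod (\<xi> 0))\<^sup>2 * G 1 \<le> G 0" "\<xi> 0 = 0 \<Longrightarrow> G 0 = 0"
    using exponential_moment_bounds[of G, OF nonneg summ eq] by auto
qed

end


section \<open>Recognising coherent states\<close>

lemma is_coherent_state_of_geometric:
  assumes \<xi>: "l2 \<xi>" "sqnorm \<xi> = 1" and nz: "\<xi> 0 \<noteq> 0"
    and geo: "\<And>n. bargmann_deriv \<xi> (Suc n) = \<gamma> * bargmann_deriv \<xi> n"
  shows "is_coherent_state \<xi>"
proof -
  \<comment> \<open>The factor \<open>sqrt 2\<close> undoes the power of 2 in
    \<open>bargmann_deriv\<close>.\<close>
  define \<beta> where "\<beta> = of_real (sqrt 2) * \<gamma>"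
  have b: "bargmann_deriv \<xi> n = \<gamma> ^ n * \<xi> 0" for n
  proof (induction n)
    case 0
    show ?case by (simp add: bargmann_deriv_def)
  qed (simp add: geo)
  have x: "\<xi> n = \<xi> 0 * (\<beta> ^ n / of_real (sqrt (fact n)))" for n
    using b[of n]
    by (simp add: bargmann_deriv_def \<beta>_def real_sqrt_divide real_sqrt_power power_mult_distrib field_simps)
  have "(\<lambda>n. ((cmod \<beta>)\<^sup>2) ^ n / fact n) sums exp ((cmod \<beta>)\<^sup>2)"
    using exp_converges[of "(cmod \<beta>)\<^sup>2"] by (simp add: field_simps)
  then have s: "(\<lambda>n. (cmod (\<xi> 0))\<^sup>2 * (((cmod \<beta>)\<^sup>2) ^ n / fact n)) sums ((cmod (\<xi> 0))\<^sup>2 * exp ((cmod \<beta>)\<^sup>2))"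
    by (rule sums_mult)
  have "(cmod (\<xi> 0))\<^sup>2 * (((cmod \<beta>)\<^sup>2) ^ n / fact n) = (cmod (\<xi> n))\<^sup>2" for n
    by (subst (2) x) (simp add: norm_mult norm_divide norm_power power_mult_distrib power_divide mult.commute
        flip: power_mult)
  with s have "(\<lambda>n. (cmod (\<xi> n))\<^sup>2) sums ((cmod (\<xi> 0))\<^sup>2 * exp ((cmod \<beta>)\<^sup>2))"
    by (simp only:)
  moreover have "(\<lambda>n. (cmod (\<xi> n))\<^sup>2) sums 1"
    using \<xi> unfolding l2_def sqnorm_def by (metis has_sum_infsum has_sum_imp_sums)
  ultimately have e: "(cmod (\<xi> 0))\<^sup>2 * exp ((cmod \<beta>)\<^sup>2) = 1"
    by (rule sums_unique2)
  have "(cmod (\<xi> 0))\<^sup>2 = (exp (- ((cmod \<beta>)\<^sup>2) / 2))\<^sup>2"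
    using e by (simp add: power2_eq_square exp_minus field_simps flip: exp_add)
  \<comment> \<open>Normalisation fixes the modulus of \<open>\<xi> 0\<close>; only the global phase
    \<open>c\<close> remains free.\<close>
  then have m: "cmod (\<xi> 0) = exp (- ((cmod \<beta>)\<^sup>2) / 2)"
    by (rule power2_eq_imp_eq) auto
  define c where "c = \<xi> 0 / of_real (cmod (\<xi> 0))"
  have "cmod c = 1" using nz by (simp add: c_def norm_divide)
  moreover have "\<xi> = (\<lambda>n. c * coherent \<beta> n)"
  proof
    fix n
    have "coherent \<beta> n = of_real (cmod (\<xi> 0)) * (\<beta> ^ n / of_real (sqrt (fact n)))"
      by (simp add: coherent_def m)
    then show "\<xi> n = c * coherent \<beta> n"
      using nz by (subst x) (simp add: c_def)
  qed
  ultimately show ?thesis unfolding is_coherent_state_def by blast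
qed

lemma coherent_of_no_violation:
  assumes \<xi>: "l2 \<xi>" "sqnorm \<xi> = 1" "cmod (\<xi> 0) < 1"
    and no_violation: "\<And>PA0 PA1 PB0 PB1. two_outcome_pvm PA0 PA1 \<Longrightarrow> two_outcome_pvm PB0 PB1 \<Longrightarrow>
      gyni \<xi> PA0 PA1 PB0 PB1 \<le> 1 / 2"
  shows "is_coherent_state \<xi>"
proof -
  let ?\<mu> = "bargmann_deriv \<xi>"
  note G = bargmann_deriv_moments[OF \<xi> no_violation]
  have nz: "\<xi> 0 \<noteq> 0"
  proof
    assume "\<xi> 0 = 0"
    then have "?\<mu> n = 0" for n
      \<comment> \<open>With shift \<open>n\<close>, \<open>a = 1\<close> and \<open>b = 0\<close>,
        the value \<open>G 0\<close> is the squared modulus of \<open>?\<mu> n\<close>.\<close>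
      using G(2)[of 1 n 0] by simp
    then have "\<xi> = (\<lambda>_. 0)"
      by (auto simp: bargmann_deriv_def)
    then show False using \<xi>(2) by (simp add: sqnorm_def)
  qed
  have \<mu>0: "?\<mu> 0 = \<xi> 0" by (simp add: bargmann_deriv_def)
  have "?\<mu> (Suc n) = ?\<mu> 1 / ?\<mu> 0 * ?\<mu> n" for n
  proof -
    have "2 * (cmod (\<xi> 0))\<^sup>2 * (cmod (?\<mu> 0 * ?\<mu> (1 + n) + - ?\<mu> n * ?\<mu> 1))\<^sup>2 \<le> 0"
      using G(1)[of "?\<mu> 0" n "- ?\<mu> n"] by simp
    then have "?\<mu> 0 * ?\<mu> (1 + n) + - ?\<mu> n * ?\<mu> 1 = 0"
      using nz by (simp add: mult_le_0_iff)
    then show ?thesis using nz \<mu>0 by (simp add: field_simps)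
  qed
  then show ?thesis by (rule is_coherent_state_of_geometric[OF \<xi>(1,2) nz])
qed

theorem theorem1:
  fixes \<xi> :: "nat \<Rightarrow> complex"
  assumes "l2 \<xi>" and "sqnorm \<xi> = 1" and "cmod (\<xi> 0) < 1"
  shows "(\<exists>PA0 PA1 PB0 PB1. two_outcome_pvm PA0 PA1 \<and> two_outcome_pvm PB0 PB1 \<and>
            gyni \<xi> PA0 PA1 PB0 PB1 > 1/2) \<longleftrightarrow> \<not> is_coherent_state \<xi>"
  using gyni_coherent_le[OF assms] coherent_of_no_violation[OF assms] by (meson not_le)

end
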